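(* Let $dWHA$ be the free Abelian group on the set of substitutions (defined in the context), graded by $\deg\binom{\rho}{\sigma}=\#\mathrm{supp}(\rho)$, equipped with the multiplication $m$, unit $e$, comultiplication $\mu$ and counit $\varepsilon$ described in the context. Then $(dWHA,m,\mu,e,\varepsilon)$ is a connected graded bialgebra (multiplication and unit are coalgebra morphisms, equivalently comultiplication and counit are algebra morphisms), and consequently it has an antipode making it a connected graded Hopf algebra over $\mathbf{Z}$.
   Context: Fix an infinite auxiliary alphabet $\mathcal{X}=\{x_1,x_2,\dots\}$. A word is a finite sequence $[a_1,\dots,a_m]$ of letters; its support $\mathrm{supp}$ is the set of distinct letters occurring in it; a subword of $[a_1,\dots,a_m]$ is $[a_{i_1},\dots,a_{i_r}]$ with $i_1<\dots<i_r$. A substitution is a pair of words $p=\binom{\rho}{\sigma}$ over $\mathcal{X}$ with $\mathrm{supp}(\rho)=\mathrm{supp}(\sigma)$, considered up to renaming: $\binom{\rho}{\sigma}$ and $\binom{\rho'}{\sigma'}$ are the same substitution iff there is a bijection $\vartheta:\mathrm{supp}(\rho)\to\mathrm{supp}(\rho')$ whose letterwise extension maps $\rho$ to $\rho'$ and $\sigma$ to $\sigma'$. The empty substitution $\binom{[\,]}{[\,]}$ is included. The shuffle product $\times_{sh}$ of words $[a_1,\dots,a_m]$ and $[b_1,\dots,b_n]$ is the sum (with multiplicities) of all words of length $m+n$ obtained by choosing $m$ of the $m+n$ positions, placing $a_1,\dots,a_m$ there in order and $b_1,\dots,b_n$ in the remaining positions in order. Multiplication: for substitutions $\binom{\rho}{\sigma},\binom{\rho'}{\sigma'}$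 written with $\mathrm{supp}(\rho)\cap\mathrm{supp}(\rho')=\emptyset$, their product is $\sum_\gamma \binom{\rho\rho'}{\gamma}$, the sum over the terms $\gamma$ (with multiplicity) of $\sigma\times_{sh}\sigma'$, where $\rho\rho'$ is concatenation. The unit is the empty substitution. A cut $\sigma=\sigma_1\sigma_2$ (concatenation, trivial cuts allowed) is good if $\mathrm{supp}(\sigma_1)\cap\mathrm{supp}(\sigma_2)=\emptyset$. For $p=\binom{\rho}{\sigma}$ and a subword $\sigma_1$ of $\sigma$, $p^{-1}(\sigma_1)$ denotes the subword of $\rho$ consisting of all letters of $\rho$ lying in $\mathrm{supp}(\sigma_1)$. Comultiplication: $\mu\binom{\rho}{\sigma}=\sum \binom{p^{-1}(\sigma_1)}{\sigma_1}\otimes\binom{p^{-1}(\sigma_2)}{\sigma_2}$, sum over all good cuts $\sigma=\sigma_1\sigma_2$. Counit: $\varepsilon$ is $1$ on the empty substitution and $0$ on all other substitutions. *)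

theory Defs
  imports
    Complex_Main
    "HOL-Library.Poly_Mapping"
    "HOL-Computational_Algebra.Group_Closure"
begin

section \<open>Abelian groups as \<open>\<int>\<close>-modules\<close>

definition zscale :: "int \<Rightarrow> 'a::ab_group_add \<Rightarrow> 'a" where
  "zscale k x = (\<Sum>i<nat k. x) - (\<Sum>i<nat (- k). x)"

lemma zscale_diff_nat: "zscale (int m - int n) x = (\<Sum>i<m. x) - (\<Sum>i<n. x)"
proof (cases "n \<le> m")
  case True
  then obtain d where "m = n + d" using le_Suc_ex by blast
  moreover have "(\<Sum>i<n + d. x) = (\<Sum>i<n. x) + (\<Sum>i<d. x)"
    by (induction d) (auto simp: algebra_simps)
  ultimately show ?thesis by (simp add: zscale_def)
next
  case False
  then obtain d where "n = m + d" using le_Suc_ex by (metis nat_le_linear)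
  moreover have "(\<Sum>i<m + d. x) = (\<Sum>i<m. x) + (\<Sum>i<d. x)"
    by (induction d) (auto simp: algebra_simps)
  ultimately show ?thesis by (simp add: zscale_def)
qed

lemma zscale_zero [simp]: "zscale 0 x = 0"
  by (simp add: zscale_def)

lemma zscale_one [simp]: "zscale 1 x = x"
  by (simp add: zscale_def)

lemma zscale_add_left: "zscale (k + l) x = zscale k x + zscale l x"
proof -
  obtain m n where k: "k = int m - int n" using int_diff_cases by blast
  obtain m' n' where l: "l = int m' - int n'" using int_diff_cases by blast
  have kl: "k + l = int (m + m') - int (n + n')" using k l by simp
  have split: "(\<Sum>i<a + b. x) = (\<Sum>i<a. x) + (\<Sum>i<b. x)" for a b :: nat
    by (induction b) (auto simp: algebra_simps)
  show ?thesis
    unfolding kl zscale_diff_nat unfolding k l zscale_diff_nat split by (simp add: algebra_simps)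
qed

lemma zscale_add_right: "zscale k (x + y) = zscale k x + zscale k y"
  by (simp add: zscale_def sum.distrib)

lemma zscale_int [simp]: "zscale k (l::int) = k * l"
  by (simp add: zscale_def algebra_simps)

text \<open>The additive extension of a map defined on a basis; \<open>frag_extend\<close> is the special case
  of free target groups.\<close>

definition free_lift :: "('b \<Rightarrow> 'a::ab_group_add) \<Rightarrow> ('b \<Rightarrow>\<^sub>0 int) \<Rightarrow> 'a" where
  "free_lift f x = (\<Sum>i\<in>Poly_Mapping.keys x. zscale (Poly_Mapping.lookup x i) (f i))"

lemma free_lift_superset:
  assumes "finite S" "Poly_Mapping.keys x \<subseteq> S"
  shows "free_lift f x = (\<Sum>i\<in>S. zscale (Poly_Mapping.lookup x i) (f i))"
  unfolding free_lift_def
  by (rule sum.mono_neutral_left) (use assms in \<open>auto simp: in_keys_iff\<close>)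

lemma free_lift_of [simp]: "free_lift f (frag_of a) = f a"
  by (simp add: free_lift_def)

lemma free_lift_add: "free_lift f (x + y) = free_lift f x + free_lift f y"
proof -
  let ?S = "Poly_Mapping.keys x \<union> Poly_Mapping.keys y"
  have "Poly_Mapping.keys (x + y) \<subseteq> ?S" by (rule Poly_Mapping.keys_add)
  then show ?thesis
    by (simp add: free_lift_superset [of ?S] lookup_add zscale_add_left sum.distrib)
qed

lemma free_lift_fun_add: "free_lift (\<lambda>i. f i + g i) x = free_lift f x + free_lift g x"
  by (simp add: free_lift_def zscale_add_right sum.distrib)

lemma additive_free_lift: "additive (free_lift f)"
  by (rule additive.intro) (rule free_lift_add)


section \<open>Tensor product of abelian groups\<close>

text \<open>\<open>A \<otimes> B\<close> is the free abelian group on \<open>A \<times> B\<close> modulo the bilinearity relations.\<close>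

definition tensor_relators :: "('a::ab_group_add \<times> 'b::ab_group_add \<Rightarrow>\<^sub>0 int) set" where
  "tensor_relators =
     {frag_of (a + a', b) - frag_of (a, b) - frag_of (a', b) | a a' b. True} \<union>
     {frag_of (a, b + b') - frag_of (a, b) - frag_of (a, b') | a b b'. True}"

definition tensor_rel ::
    "('a::ab_group_add \<times> 'b::ab_group_add \<Rightarrow>\<^sub>0 int) \<Rightarrow> ('a \<times> 'b \<Rightarrow>\<^sub>0 int) \<Rightarrow> bool" where
  "tensor_rel x y \<longleftrightarrow> x - y \<in> group_closure tensor_relators"

lemma equivp_tensor_rel:
  "equivp (tensor_rel :: ('a::ab_group_add \<times> 'b::ab_group_add \<Rightarrow>\<^sub>0 int) \<Rightarrow> _)"
proof (rule equivpI)
  show "reflp (tensor_rel :: ('a \<times> 'b \<Rightarrow>\<^sub>0 int) \<Rightarrow> _)" by (auto simp: reflp_def tensor_rel_def)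
  show "symp (tensor_rel :: ('a \<times> 'b \<Rightarrow>\<^sub>0 int) \<Rightarrow> _)"
    unfolding symp_def tensor_rel_def by (metis group_closure_minus_iff minus_diff_eq)
  show "transp (tensor_rel :: ('a \<times> 'b \<Rightarrow>\<^sub>0 int) \<Rightarrow> _)"
  proof (rule transpI)
    fix x y z :: "'a \<times> 'b \<Rightarrow>\<^sub>0 int"
    assume "tensor_rel x y" "tensor_rel y z"
    then have "(x - y) + (y - z) \<in> group_closure tensor_relators"
      unfolding tensor_rel_def by (rule group_closure_add)
    then show "tensor_rel x z" by (simp add: tensor_rel_def)
  qed
qed

quotient_type (overloaded) ('a, 'b) tensor =
    "('a::ab_group_add \<times> 'b::ab_group_add) \<Rightarrow>\<^sub>0 int" / tensor_rel
  by (rule equivp_tensor_rel)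

instantiation tensor :: (ab_group_add, ab_group_add) ab_group_add
begin

lift_definition zero_tensor :: "('a, 'b) tensor" is 0 .

lift_definition plus_tensor :: "('a, 'b) tensor \<Rightarrow> ('a, 'b) tensor \<Rightarrow> ('a, 'b) tensor" is "(+)"
proof -
  fix x x' y y' :: "'a \<times> 'b \<Rightarrow>\<^sub>0 int"
  assume "tensor_rel x x'" "tensor_rel y y'"
  then have "(x - x') + (y - y') \<in> group_closure tensor_relators"
    unfolding tensor_rel_def by (rule group_closure_add)
  then show "tensor_rel (x + y) (x' + y')" by (simp add: tensor_rel_def algebra_simps)
qed

lift_definition uminus_tensor :: "('a, 'b) tensor \<Rightarrow> ('a, 'b) tensor" is uminus
proof -
  fix x x' :: "'a \<times> 'b \<Rightarrow>\<^sub>0 int"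
  assume "tensor_rel x x'"
  then have "- (x - x') \<in> group_closure tensor_relators"
    unfolding tensor_rel_def by (simp only: group_closure_minus_iff)
  then show "tensor_rel (- x) (- x')" by (simp add: tensor_rel_def)
qed

lift_definition minus_tensor :: "('a, 'b) tensor \<Rightarrow> ('a, 'b) tensor \<Rightarrow> ('a, 'b) tensor" is "(-)"
proof -
  fix x x' y y' :: "'a \<times> 'b \<Rightarrow>\<^sub>0 int"
  assume "tensor_rel x x'" "tensor_rel y y'"
  then have "(x - x') - (y - y') \<in> group_closure tensor_relators"
    unfolding tensor_rel_def by (rule group_closure.diff)
  then show "tensor_rel (x - y) (x' - y')" by (simp add: tensor_rel_def algebra_simps)
qed

instance
  by standard (transfer; simp add: tensor_rel_def algebra_simps)+

end

lift_definition tens :: "'a::ab_group_add \<Rightarrow> 'b::ab_group_add \<Rightarrow> ('a, 'b) tensor"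
    (infixl "\<otimes>\<^sub>Z" 72) is
  "\<lambda>a b. frag_of (a, b)" .

lemma tens_add_left: "(a + a') \<otimes>\<^sub>Z b = a \<otimes>\<^sub>Z b + a' \<otimes>\<^sub>Z b"
proof transfer
  fix a a' :: 'a and b :: 'b
  have "frag_of (a + a', b) - frag_of (a, b) - frag_of (a', b) \<in> tensor_relators"
    unfolding tensor_relators_def by blast
  then show "tensor_rel (frag_of (a + a', b)) (frag_of (a, b) + frag_of (a', b))"
    unfolding tensor_rel_def by (metis group_closure.base insertI2 diff_diff_add)
qed

lemma tens_add_right: "a \<otimes>\<^sub>Z (b + b') = a \<otimes>\<^sub>Z b + a \<otimes>\<^sub>Z b'"
proof transfer
  fix a :: 'a and b b' :: 'b
  have "frag_of (a, b + b') - frag_of (a, b) - frag_of (a, b') \<in> tensor_relators"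
    unfolding tensor_relators_def by blast
  then show "tensor_rel (frag_of (a, b + b')) (frag_of (a, b) + frag_of (a, b'))"
    unfolding tensor_rel_def by (metis group_closure.base insertI2 diff_diff_add)
qed

lemma tensor_induct [case_names zero tens diff]:
  assumes "P 0" "\<And>a b. P (a \<otimes>\<^sub>Z b)" "\<And>s t. P s \<Longrightarrow> P t \<Longrightarrow> P (s - t)"
  shows "P t"
proof -
  have "P (abs_tensor x)" for x
  proof (induction x rule: frag_induction [OF subset_UNIV])
    case 1
    then show ?case using assms(1) by (simp add: zero_tensor_def)
  next
    case (2 x)
    then show ?case using assms(2) by (cases x) (metis tens.abs_eq)
  next
    case (3 x y)
    then show ?case using assms(3) by (metis minus_tensor.abs_eq)
  qed
  then show ?thesis by (metis Quotient_tensor Quotient_abs_rep)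
qed

definition biadditive :: "('a::ab_group_add \<Rightarrow> 'b::ab_group_add \<Rightarrow> 'c::ab_group_add) \<Rightarrow> bool" where
  "biadditive f \<longleftrightarrow> (\<forall>b. additive (\<lambda>a. f a b)) \<and> (\<forall>a. additive (f a))"

text \<open>The additive map on \<open>A \<otimes> B\<close> induced by a biadditive map; it is meaningful for biadditive
  arguments only, see the two characterising lemmas below.\<close>

definition tensor_lift ::
    "('a::ab_group_add \<Rightarrow> 'b::ab_group_add \<Rightarrow> 'c::ab_group_add) \<Rightarrow> ('a, 'b) tensor \<Rightarrow> 'c" where
  "tensor_lift f t = free_lift (\<lambda>(a, b). f a b) (rep_tensor t)"

lemma free_lift_tensor_rel:
  assumes "biadditive f" "tensor_rel x y"
  shows "free_lift (\<lambda>(a, b). f a b) x = free_lift (\<lambda>(a, b). f a b) y"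
proof -
  let ?F = "free_lift (\<lambda>(a, b). f a b)"
  interpret F: additive ?F by (rule additive_free_lift)
  have "?F z = 0" if "z \<in> group_closure tensor_relators" for z
    using that
  proof induction
    case (base s)
    have l: "f (a + a') b = f a b + f a' b" and r: "f a (b + b') = f a b + f a b'" for a a' b b'
      using assms(1) by (auto simp: biadditive_def additive_def)
    from base show ?case
      by (auto simp: tensor_relators_def F.diff F.zero l r)
  qed (simp add: F.diff)
  from this [of "x - y"] assms(2) show ?thesis by (simp add: tensor_rel_def F.diff)
qed

lemma tensor_lift_abs:
  assumes "biadditive f"
  shows "tensor_lift f (abs_tensor x) = free_lift (\<lambda>(a, b). f a b) x"
  unfolding tensor_lift_def
  by (rule free_lift_tensor_rel [OF assms])
    (metis Quotient_tensor Quotient_rep_abs equivp_reflp equivp_tensor_rel)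

lemma tensor_lift_tens:
  "biadditive f \<Longrightarrow> tensor_lift f (a \<otimes>\<^sub>Z b) = f a b"
  by (simp add: tens.abs_eq tensor_lift_abs)

lemma additive_tensor_lift:
  assumes "biadditive f"
  shows "additive (tensor_lift f)"
proof
  fix s t :: "('a, 'b) tensor"
  obtain x y where "s = abs_tensor x" "t = abs_tensor y"
    by (metis Quotient_tensor Quotient_abs_rep)
  then show "tensor_lift f (s + t) = tensor_lift f s + tensor_lift f t"
    by (simp add: plus_tensor.abs_eq tensor_lift_abs assms free_lift_add)
qed

definition tensor_map ::
    "('a::ab_group_add \<Rightarrow> 'c::ab_group_add) \<Rightarrow> ('b::ab_group_add \<Rightarrow> 'd::ab_group_add) \<Rightarrow>
     ('a, 'b) tensor \<Rightarrow> ('c, 'd) tensor" where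
  "tensor_map f g = tensor_lift (\<lambda>a b. f a \<otimes>\<^sub>Z g b)"

definition tensor_assoc ::
    "(('a::ab_group_add, 'b::ab_group_add) tensor, 'c::ab_group_add) tensor \<Rightarrow>
     ('a, ('b, 'c) tensor) tensor" where
  "tensor_assoc = tensor_lift (\<lambda>s c. tensor_lift (\<lambda>a b. a \<otimes>\<^sub>Z (b \<otimes>\<^sub>Z c)) s)"

definition tensor_interchange ::
    "(('a::ab_group_add, 'b::ab_group_add) tensor, ('c::ab_group_add, 'd::ab_group_add) tensor) tensor \<Rightarrow>
     (('a, 'c) tensor, ('b, 'd) tensor) tensor" where
  "tensor_interchange =
     tensor_lift (\<lambda>s t. tensor_lift (\<lambda>a b. tensor_lift (\<lambda>c d. (a \<otimes>\<^sub>Z c) \<otimes>\<^sub>Z (b \<otimes>\<^sub>Z d)) t) s)"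

definition tensor_lunit :: "(int, 'a::ab_group_add) tensor \<Rightarrow> 'a" where
  "tensor_lunit = tensor_lift zscale"

definition tensor_runit :: "('a::ab_group_add, int) tensor \<Rightarrow> 'a" where
  "tensor_runit = tensor_lift (\<lambda>a k. zscale k a)"

lemma biadditive_tens:
  "additive f \<Longrightarrow> additive g \<Longrightarrow> biadditive (\<lambda>a b. f a \<otimes>\<^sub>Z g b)"
  by (simp add: biadditive_def additive_def tens_add_left tens_add_right)

lemma tensor_map_tens:
  "additive f \<Longrightarrow> additive g \<Longrightarrow> tensor_map f g (a \<otimes>\<^sub>Z b) = f a \<otimes>\<^sub>Z g b"
  unfolding tensor_map_def by (rule tensor_lift_tens) (rule biadditive_tens)

lemma additive_eqI:
  assumes "additive f" "additive g" "\<And>a b. f (a \<otimes>\<^sub>Z b) = g (a \<otimes>\<^sub>Z b)"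
  shows "f t = g t"
proof -
  interpret f: additive f by fact
  interpret g: additive g by fact
  show ?thesis
    by (induction t rule: tensor_induct) (simp_all add: f.zero g.zero f.diff g.diff assms(3))
qed

lemma additive_tensor_lift_param:
  assumes "\<And>x. biadditive (f x)" "\<And>a b. additive (\<lambda>x. f x a b)"
  shows "additive (\<lambda>x. tensor_lift (f x) t)"
proof
  fix x y
  have bi: "additive (tensor_lift (f z))" for z by (rule additive_tensor_lift [OF assms(1)])
  show "tensor_lift (f (x + y)) t = tensor_lift (f x) t + tensor_lift (f y) t"
  proof (rule additive_eqI [OF bi])
    show "additive (\<lambda>t. tensor_lift (f x) t + tensor_lift (f y) t)"
      using bi [of x] bi [of y] by (simp add: additive_def algebra_simps)
    show "tensor_lift (f (x + y)) (a \<otimes>\<^sub>Z b) =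
        tensor_lift (f x) (a \<otimes>\<^sub>Z b) + tensor_lift (f y) (a \<otimes>\<^sub>Z b)" for a b
      using assms(2) by (simp add: tensor_lift_tens assms(1) additive_def)
  qed
qed

lemma biadditiveI:
  "(\<And>b. additive (\<lambda>a. f a b)) \<Longrightarrow> (\<And>a. additive (f a)) \<Longrightarrow> biadditive f"
  by (simp add: biadditive_def)

lemma biadditive_tens_assoc: "biadditive (\<lambda>a b. a \<otimes>\<^sub>Z (b \<otimes>\<^sub>Z c))"
  by (simp add: biadditive_def additive_def tens_add_left tens_add_right)

lemma biadditive_tensor_assoc:
  "biadditive (\<lambda>s c. tensor_lift (\<lambda>a b. a \<otimes>\<^sub>Z (b \<otimes>\<^sub>Z c)) s)"
  by (intro biadditiveI additive_tensor_lift additive_tensor_lift_param biadditive_tens_assoc)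
    (simp add: additive_def tens_add_right)

lemma tensor_assoc_tens: "tensor_assoc ((a \<otimes>\<^sub>Z b) \<otimes>\<^sub>Z c) = a \<otimes>\<^sub>Z (b \<otimes>\<^sub>Z c)"
  by (simp add: tensor_assoc_def tensor_lift_tens biadditive_tensor_assoc biadditive_tens_assoc)

lemma biadditive_tens_interchange: "biadditive (\<lambda>c d. (a \<otimes>\<^sub>Z c) \<otimes>\<^sub>Z (b \<otimes>\<^sub>Z d))"
  by (simp add: biadditive_def additive_def tens_add_left tens_add_right)

lemma biadditive_tens_interchange':
  "biadditive (\<lambda>a b. tensor_lift (\<lambda>c d. (a \<otimes>\<^sub>Z c) \<otimes>\<^sub>Z (b \<otimes>\<^sub>Z d)) t)"
  by (rule biadditiveI; rule additive_tensor_lift_param)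
    (simp_all add: biadditive_tens_interchange additive_def tens_add_left tens_add_right)

lemma biadditive_tensor_interchange:
  "biadditive (\<lambda>s t. tensor_lift (\<lambda>a b. tensor_lift (\<lambda>c d. (a \<otimes>\<^sub>Z c) \<otimes>\<^sub>Z (b \<otimes>\<^sub>Z d)) t) s)"
  by (intro biadditiveI additive_tensor_lift additive_tensor_lift_param
      biadditive_tens_interchange' biadditive_tens_interchange)

lemma tensor_interchange_tens:
  "tensor_interchange ((a \<otimes>\<^sub>Z b) \<otimes>\<^sub>Z (c \<otimes>\<^sub>Z d)) = (a \<otimes>\<^sub>Z c) \<otimes>\<^sub>Z (b \<otimes>\<^sub>Z d)"
  by (simp add: tensor_interchange_def tensor_lift_tens biadditive_tensor_interchange
      biadditive_tens_interchange biadditive_tens_interchange')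

lemma tensor_lunit_tens: "tensor_lunit (k \<otimes>\<^sub>Z a) = zscale k a"
  unfolding tensor_lunit_def
  by (rule tensor_lift_tens) (simp add: biadditive_def additive_def zscale_add_left zscale_add_right)

lemma tensor_runit_tens: "tensor_runit (a \<otimes>\<^sub>Z k) = zscale k a"
  unfolding tensor_runit_def
  by (rule tensor_lift_tens) (simp add: biadditive_def additive_def zscale_add_left zscale_add_right)


section \<open>Bialgebras and Hopf algebras over \<open>\<int>\<close>\<close>

text \<open>The variables \<open>m\<close>, \<open>e\<close>, \<open>\<mu>\<close>, \<open>\<epsilon>\<close> are multiplication, unit, comultiplication and counit.\<close>

definition algebra ::
    "(('a::ab_group_add, 'a) tensor \<Rightarrow> 'a) \<Rightarrow> (int \<Rightarrow> 'a) \<Rightarrow> bool" where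
  "algebra m e \<longleftrightarrow> additive m \<and> additive e \<and>
     m \<circ> tensor_map m id = m \<circ> tensor_map id m \<circ> tensor_assoc \<and>
     m \<circ> tensor_map e id = tensor_lunit \<and>
     m \<circ> tensor_map id e = tensor_runit"

definition coalgebra ::
    "('a::ab_group_add \<Rightarrow> ('a, 'a) tensor) \<Rightarrow> ('a \<Rightarrow> int) \<Rightarrow> bool" where
  "coalgebra \<mu> \<epsilon> \<longleftrightarrow> additive \<mu> \<and> additive \<epsilon> \<and>
     tensor_assoc \<circ> tensor_map \<mu> id \<circ> \<mu> = tensor_map id \<mu> \<circ> \<mu> \<and>
     tensor_lunit \<circ> tensor_map \<epsilon> id \<circ> \<mu> = id \<and>
     tensor_runit \<circ> tensor_map id \<epsilon> \<circ> \<mu> = id"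

definition algebra_hom ::
    "(('a::ab_group_add, 'a) tensor \<Rightarrow> 'a) \<Rightarrow> (int \<Rightarrow> 'a) \<Rightarrow>
     (('b::ab_group_add, 'b) tensor \<Rightarrow> 'b) \<Rightarrow> (int \<Rightarrow> 'b) \<Rightarrow> ('a \<Rightarrow> 'b) \<Rightarrow> bool" where
  "algebra_hom m e m' e' f \<longleftrightarrow> additive f \<and> f \<circ> m = m' \<circ> tensor_map f f \<and> f \<circ> e = e'"

definition coalgebra_hom ::
    "('a::ab_group_add \<Rightarrow> ('a, 'a) tensor) \<Rightarrow> ('a \<Rightarrow> int) \<Rightarrow>
     ('b::ab_group_add \<Rightarrow> ('b, 'b) tensor) \<Rightarrow> ('b \<Rightarrow> int) \<Rightarrow> ('a \<Rightarrow> 'b) \<Rightarrow> bool" where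
  "coalgebra_hom \<mu> \<epsilon> \<mu>' \<epsilon>' f \<longleftrightarrow> additive f \<and> \<mu>' \<circ> f = tensor_map f f \<circ> \<mu> \<and> \<epsilon>' \<circ> f = \<epsilon>"

text \<open>The ground ring \<open>\<int>\<close> as algebra and as coalgebra (its unit and counit are the identity), and
  the algebra and coalgebra structures on \<open>A \<otimes> A\<close>.\<close>

definition int_mult :: "(int, int) tensor \<Rightarrow> int" where
  "int_mult = tensor_lift (*)"

definition int_comult :: "int \<Rightarrow> (int, int) tensor" where
  "int_comult k = k \<otimes>\<^sub>Z 1"

definition tensor_mult ::
    "(('a::ab_group_add, 'a) tensor \<Rightarrow> 'a) \<Rightarrow>
     (('a, 'a) tensor, ('a, 'a) tensor) tensor \<Rightarrow> ('a, 'a) tensor" where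
  "tensor_mult m = tensor_map m m \<circ> tensor_interchange"

definition tensor_unit :: "(int \<Rightarrow> 'a::ab_group_add) \<Rightarrow> int \<Rightarrow> ('a, 'a) tensor" where
  "tensor_unit e = tensor_map e e \<circ> int_comult"

definition tensor_comult ::
    "('a::ab_group_add \<Rightarrow> ('a, 'a) tensor) \<Rightarrow>
     ('a, 'a) tensor \<Rightarrow> (('a, 'a) tensor, ('a, 'a) tensor) tensor" where
  "tensor_comult \<mu> = tensor_interchange \<circ> tensor_map \<mu> \<mu>"

definition tensor_counit :: "('a::ab_group_add \<Rightarrow> int) \<Rightarrow> ('a, 'a) tensor \<Rightarrow> int" where
  "tensor_counit \<epsilon> = int_mult \<circ> tensor_map \<epsilon> \<epsilon>"

definition bialgebra ::
    "(('a::ab_group_add, 'a) tensor \<Rightarrow> 'a) \<Rightarrow> (int \<Rightarrow> 'a) \<Rightarrow>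
     ('a \<Rightarrow> ('a, 'a) tensor) \<Rightarrow> ('a \<Rightarrow> int) \<Rightarrow> bool" where
  "bialgebra m e \<mu> \<epsilon> \<longleftrightarrow> algebra m e \<and> coalgebra \<mu> \<epsilon> \<and>
     coalgebra_hom (tensor_comult \<mu>) (tensor_counit \<epsilon>) \<mu> \<epsilon> m \<and>
     coalgebra_hom int_comult id \<mu> \<epsilon> e"

text \<open>An internal direct sum decomposition into the subgroups \<open>A n\<close>.\<close>

definition grading :: "(nat \<Rightarrow> 'a::ab_group_add set) \<Rightarrow> bool" where
  "grading A \<longleftrightarrow> (\<forall>n. 0 \<in> A n \<and> (\<forall>x\<in>A n. \<forall>y\<in>A n. x - y \<in> A n)) \<and>
     (\<forall>x. \<exists>!c. finite {n. c n \<noteq> 0} \<and> (\<forall>n. c n \<in> A n) \<and> x = (\<Sum>n | c n \<noteq> 0. c n))"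

definition tensor_grade ::
    "(nat \<Rightarrow> 'a::ab_group_add set) \<Rightarrow> nat \<Rightarrow> ('a, 'a) tensor set" where
  "tensor_grade A n = group_closure {a \<otimes>\<^sub>Z b | a b i j. a \<in> A i \<and> b \<in> A j \<and> i + j = n}"

text \<open>All structure maps are homogeneous of degree 0, with \<open>\<int>\<close> concentrated in degree 0.\<close>

definition graded_bialgebra ::
    "(nat \<Rightarrow> 'a::ab_group_add set) \<Rightarrow> (('a, 'a) tensor \<Rightarrow> 'a) \<Rightarrow> (int \<Rightarrow> 'a) \<Rightarrow>
     ('a \<Rightarrow> ('a, 'a) tensor) \<Rightarrow> ('a \<Rightarrow> int) \<Rightarrow> bool" where
  "graded_bialgebra A m e \<mu> \<epsilon> \<longleftrightarrow> bialgebra m e \<mu> \<epsilon> \<and> grading A \<and>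
     (\<forall>n. m ` tensor_grade A n \<subseteq> A n) \<and> range e \<subseteq> A 0 \<and>
     (\<forall>n. \<mu> ` A n \<subseteq> tensor_grade A n) \<and> (\<forall>n>0. \<epsilon> ` A n \<subseteq> {0})"

definition connected_graded_bialgebra ::
    "(nat \<Rightarrow> 'a::ab_group_add set) \<Rightarrow> (('a, 'a) tensor \<Rightarrow> 'a) \<Rightarrow> (int \<Rightarrow> 'a) \<Rightarrow>
     ('a \<Rightarrow> ('a, 'a) tensor) \<Rightarrow> ('a \<Rightarrow> int) \<Rightarrow> bool" where
  "connected_graded_bialgebra A m e \<mu> \<epsilon> \<longleftrightarrow>
     graded_bialgebra A m e \<mu> \<epsilon> \<and> bij_betw e UNIV (A 0)"

definition antipode ::
    "(('a::ab_group_add, 'a) tensor \<Rightarrow> 'a) \<Rightarrow> (int \<Rightarrow> 'a) \<Rightarrow>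
     ('a \<Rightarrow> ('a, 'a) tensor) \<Rightarrow> ('a \<Rightarrow> int) \<Rightarrow> ('a \<Rightarrow> 'a) \<Rightarrow> bool" where
  "antipode m e \<mu> \<epsilon> S \<longleftrightarrow> additive S \<and>
     m \<circ> tensor_map S id \<circ> \<mu> = e \<circ> \<epsilon> \<and> m \<circ> tensor_map id S \<circ> \<mu> = e \<circ> \<epsilon>"

definition connected_graded_Hopf_algebra ::
    "(nat \<Rightarrow> 'a::ab_group_add set) \<Rightarrow> (('a, 'a) tensor \<Rightarrow> 'a) \<Rightarrow> (int \<Rightarrow> 'a) \<Rightarrow>
     ('a \<Rightarrow> ('a, 'a) tensor) \<Rightarrow> ('a \<Rightarrow> int) \<Rightarrow> ('a \<Rightarrow> 'a) \<Rightarrow> bool" where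
  "connected_graded_Hopf_algebra A m e \<mu> \<epsilon> S \<longleftrightarrow>
     connected_graded_bialgebra A m e \<mu> \<epsilon> \<and> antipode m e \<mu> \<epsilon> S \<and> (\<forall>n. S ` A n \<subseteq> A n)"


section \<open>Substitutions\<close>

text \<open>The alphabet \<open>{x\<^sub>1, x\<^sub>2, \<dots>}\<close> is the type of natural numbers.\<close>

type_synonym word = "nat list"

definition renaming :: "word \<times> word \<Rightarrow> word \<times> word \<Rightarrow> bool" where
  "renaming p p' \<longleftrightarrow> (case (p, p') of ((\<rho>, \<sigma>), (\<rho>', \<sigma>')) \<Rightarrow>
     set \<rho> = set \<sigma> \<and> set \<rho>' = set \<sigma>' \<and>
     (\<exists>\<theta>. bij_betw \<theta> (set \<rho>) (set \<rho>') \<and> map \<theta> \<rho> = \<rho>' \<and> map \<theta> \<sigma> = \<sigma>'))"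

lemma renamingI:
  assumes "set \<rho> = set \<sigma>" "inj_on \<theta> (set \<rho>)" "\<rho>' = map \<theta> \<rho>" "\<sigma>' = map \<theta> \<sigma>"
  shows "renaming (\<rho>, \<sigma>) (\<rho>', \<sigma>')"
  unfolding renaming_def using assms by (auto intro!: exI [of _ \<theta>] simp: bij_betw_def)

lemma renamingE:
  assumes "renaming (\<rho>, \<sigma>) (\<rho>', \<sigma>')"
  obtains \<theta> where "set \<rho> = set \<sigma>" "inj_on \<theta> (set \<rho>)" "\<rho>' = map \<theta> \<rho>" "\<sigma>' = map \<theta> \<sigma>"
  using assms unfolding renaming_def by (auto simp: bij_betw_def)

lemma renaming_sym:
  assumes "renaming p q"
  shows "renaming q p"
proof -
  obtain \<rho> \<sigma> \<rho>' \<sigma>' where pq: "p = (\<rho>, \<sigma>)" "q = (\<rho>', \<sigma>')" by (cases p, cases q)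
  with assms obtain \<theta> where t: "set \<rho> = set \<sigma>" "inj_on \<theta> (set \<rho>)" "\<rho>' = map \<theta> \<rho>" "\<sigma>' = map \<theta> \<sigma>"
    by (auto elim: renamingE)
  have "renaming (\<rho>', \<sigma>') (\<rho>, \<sigma>)"
  proof (rule renamingI)
    show "set \<rho>' = set \<sigma>'" "inj_on (inv_into (set \<rho>) \<theta>) (set \<rho>')"
      using t by (auto intro: inj_on_inv_into)
    show "\<rho> = map (inv_into (set \<rho>) \<theta>) \<rho>'" "\<sigma> = map (inv_into (set \<rho>) \<theta>) \<sigma>'"
      using t by (auto simp: inv_into_f_f intro!: map_idI [symmetric])
  qed
  then show ?thesis by (simp add: pq)
qed

lemma renaming_trans:
  assumes "renaming p q" "renaming q r"
  shows "renaming p r"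
proof -
  obtain \<rho> \<sigma> \<rho>' \<sigma>' \<rho>'' \<sigma>'' where pq: "p = (\<rho>, \<sigma>)" "q = (\<rho>', \<sigma>')" "r = (\<rho>'', \<sigma>'')"
    by (cases p, cases q, cases r)
  from assms pq obtain \<theta>
    where t: "set \<rho> = set \<sigma>" "inj_on \<theta> (set \<rho>)" "\<rho>' = map \<theta> \<rho>" "\<sigma>' = map \<theta> \<sigma>"
    by (auto elim: renamingE)
  from assms pq obtain \<tau>
    where u: "inj_on \<tau> (set \<rho>')" "\<rho>'' = map \<tau> \<rho>'" "\<sigma>'' = map \<tau> \<sigma>'"
    by (auto elim: renamingE)
  have "renaming (\<rho>, \<sigma>) (\<rho>'', \<sigma>'')"
    by (rule renamingI [of _ _ "\<tau> \<circ> \<theta>"]) (use t u in \<open>auto intro: comp_inj_on\<close>)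
  then show ?thesis by (simp add: pq)
qed

lemma renaming_refl: "set \<rho> = set \<sigma> \<Longrightarrow> renaming (\<rho>, \<sigma>) (\<rho>, \<sigma>)"
  by (rule renamingI [of _ _ id]) auto

text \<open>As \<open>renaming\<close> is reflexive exactly on the pairs with equal supports, its classes are the
  substitutions.\<close>

quotient_type subst = "word \<times> word" / partial: renaming
proof (rule part_equivpI)
  show "\<exists>p. renaming p p" using renaming_refl [of "[]" "[]"] by auto
  show "symp renaming" using renaming_sym by (auto simp: symp_def)
  show "transp renaming" using renaming_trans by (auto simp: transp_def)
qed

definition Subst :: "word \<Rightarrow> word \<Rightarrow> subst" where
  "Subst \<rho> \<sigma> = abs_subst (\<rho>, \<sigma>)"

lemma Subst_eq_iff:
  assumes "set \<rho> = set \<sigma>" "set \<rho>' = set \<sigma>'"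
  shows "Subst \<rho> \<sigma> = Subst \<rho>' \<sigma>' \<longleftrightarrow> renaming (\<rho>, \<sigma>) (\<rho>', \<sigma>')"
  unfolding Subst_def using assms renaming_refl Quotient_rel [OF Quotient_subst] by blast

lemma Subst_cases:
  obtains \<rho> \<sigma> where "p = Subst \<rho> \<sigma>" "set \<rho> = set \<sigma>"
proof -
  obtain \<rho> \<sigma> where r: "rep_subst p = (\<rho>, \<sigma>)" by (cases "rep_subst p")
  have "renaming (rep_subst p) (rep_subst p)"
    using Quotient_rep_reflp [OF Quotient_subst] .
  with r have "set \<rho> = set \<sigma>" by (simp add: renaming_def)
  moreover have "p = Subst \<rho> \<sigma>"
    using Quotient_abs_rep [OF Quotient_subst, of p] by (simp add: r Subst_def)
  ultimately show ?thesis using that by blast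
qed

abbreviation empty_subst :: subst where
  "empty_subst \<equiv> Subst [] []"

lift_definition subst_deg :: "subst \<Rightarrow> nat" is "\<lambda>(\<rho>, \<sigma>). card (set \<rho>)"
  by (auto simp: card_image elim!: renamingE)

text \<open>The word of length \<open>length u + length v\<close> with the letters of \<open>u\<close>, in order, at the positions
  in \<open>I\<close> and those of \<open>v\<close>, in order, at the other positions.\<close>

definition shuffle_at :: "nat set \<Rightarrow> word \<Rightarrow> word \<Rightarrow> word" where
  "shuffle_at I u v =
     map (\<lambda>i. if i \<in> I then u ! card {j\<in>I. j < i} else v ! card {j. j \<notin> I \<and> j < i})
       [0..<length u + length v]"

definition shuffle_positions :: "word \<Rightarrow> word \<Rightarrow> nat set set" where
  "shuffle_positions u v = {I. I \<subseteq> {..<length u + length v} \<and> card I = length u}"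

lemma finite_shuffle_positions: "finite (shuffle_positions u v)"
  unfolding shuffle_positions_def by (rule finite_subset [of _ "Pow {..<length u + length v}"]) auto

lemma shuffle_index:
  assumes "I \<in> shuffle_positions u v" "i < length u + length v"
  shows "i \<in> I \<Longrightarrow> card {j\<in>I. j < i} < length u"
    and "i \<notin> I \<Longrightarrow> card {j. j \<notin> I \<and> j < i} < length v"
proof -
  let ?N = "{..<length u + length v}"
  have I: "I \<subseteq> ?N" "card I = length u" "finite I"
    using assms(1) finite_subset by (auto simp: shuffle_positions_def)
  show "card {j\<in>I. j < i} < length u" if "i \<in> I"
    using psubset_card_mono [of I "{j\<in>I. j < i}"] I that by auto
  have "card (?N - I) = length v" using I by (subst card_Diff_subset) auto
  moreover have "{j. j \<notin> I \<and> j < i} \<subset> ?N - I" if "i \<notin> I"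
    using assms(2) that by (intro psubsetI) auto
  ultimately show "card {j. j \<notin> I \<and> j < i} < length v" if "i \<notin> I"
    using psubset_card_mono [of "?N - I"] that by (metis finite_Diff finite_lessThan)
qed

lemma shuffle_at_map:
  assumes "I \<in> shuffle_positions u v"
  shows "shuffle_at I (map f u) (map f v) = map f (shuffle_at I u v)"
  unfolding shuffle_at_def using shuffle_index [OF assms] by auto

lemma shuffle_positions_map [simp]:
  "shuffle_positions (map f u) (map g v) = shuffle_positions u v"
  by (simp add: shuffle_positions_def)

lemma set_shuffle_at:
  assumes "I \<in> shuffle_positions u v"
  shows "set (shuffle_at I u v) = set u \<union> set v"
proof
  show "set (shuffle_at I u v) \<subseteq> set u \<union> set v"
    unfolding shuffle_at_def using shuffle_index [OF assms] by auto
  let ?N = "{..<length u + length v}"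
  have I: "I \<subseteq> ?N" "card I = length u" "finite I"
    using assms finite_subset by (auto simp: shuffle_positions_def)
  have rank: "\<exists>i\<in>J. card {j\<in>J. j < i} = k" if "finite J" "k < card J" for J :: "nat set" and k
    using that
  proof (induction J arbitrary: k rule: finite_linorder_max_induct)
    case (insert b J)
    show ?case
    proof (cases "k < card J")
      case True
      then obtain i where i: "i \<in> J" "card {j\<in>J. j < i} = k" using insert by blast
      moreover have "{j \<in> insert b J. j < i} = {j\<in>J. j < i}" using insert i by auto
      ultimately show ?thesis by (metis insertI2)
    next
      case False
      then have "k = card J" using insert by (auto simp: card_insert_if split: if_splits)
      moreover have "{j \<in> insert b J. j < b} = J" using insert by auto
      ultimately show ?thesis by (metis insertI1)
    qed
  qed simp
  show "set u \<union> set v \<subseteq> set (shuffle_at I u v)"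
  proof
    fix x assume "x \<in> set u \<union> set v"
    then consider k where "k < length u" "x = u ! k" | k where "k < length v" "x = v ! k"
      by (auto simp: in_set_conv_nth)
    then show "x \<in> set (shuffle_at I u v)"
    proof cases
      case 1
      then obtain i where i: "i \<in> I" "card {j\<in>I. j < i} = k" using rank I by metis
      then show ?thesis using 1 I unfolding shuffle_at_def by (auto intro!: image_eqI [of _ _ i])
    next
      case 2
      have "card (?N - I) = length v" using I by (subst card_Diff_subset) auto
      with 2 obtain i where i: "i \<in> ?N - I" "card {j\<in>?N - I. j < i} = k"
        using rank [of "?N - I" k] by auto
      moreover have "{j\<in>?N - I. j < i} = {j. j \<notin> I \<and> j < i}" using i by auto
      ultimately have k: "card {j. j \<notin> I \<and> j < i} = k" by simp
      have "x = shuffle_at I u v ! i" "i < length (shuffle_at I u v)"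
        using i(1) by (simp_all add: shuffle_at_def 2(2) k)
      then show ?thesis by (metis nth_mem)
    qed
  qed
qed

definition shuffle_sum :: "word \<Rightarrow> word \<Rightarrow> word \<Rightarrow> word \<Rightarrow> (subst \<Rightarrow>\<^sub>0 int)" where
  "shuffle_sum \<rho> \<sigma> \<rho>' \<sigma>' =
     (\<Sum>I\<in>shuffle_positions \<sigma> \<sigma>'. frag_of (Subst (\<rho> @ \<rho>') (shuffle_at I \<sigma> \<sigma>')))"

lemma shuffle_sum_renaming:
  assumes "renaming (\<rho>, \<sigma>) (\<tau>, \<upsilon>)" "renaming (\<rho>', \<sigma>') (\<tau>', \<upsilon>')"
    and "set \<rho> \<inter> set \<rho>' = {}" "set \<tau> \<inter> set \<tau>' = {}"
  shows "shuffle_sum \<rho> \<sigma> \<rho>' \<sigma>' = shuffle_sum \<tau> \<upsilon> \<tau>' \<upsilon>'"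
proof -
  from assms(1) obtain f where f: "set \<rho> = set \<sigma>" "inj_on f (set \<rho>)" "\<tau> = map f \<rho>" "\<upsilon> = map f \<sigma>"
    by (rule renamingE)
  from assms(2) obtain g
    where g: "set \<rho>' = set \<sigma>'" "inj_on g (set \<rho>')" "\<tau>' = map g \<rho>'" "\<upsilon>' = map g \<sigma>'"
    by (rule renamingE)
  define h where "h = (\<lambda>x. if x \<in> set \<rho> then f x else g x)"
  have h: "\<tau> = map h \<rho>" "\<upsilon> = map h \<sigma>" "\<tau>' = map h \<rho>'" "\<upsilon>' = map h \<sigma>'"
    using f g assms(3) by (auto simp: h_def)
  have "inj_on h (set \<rho>)"
    using f(2) inj_on_cong [of "set \<rho>" h f] by (simp add: h_def)
  moreover have "h x = g x" if "x \<in> set \<rho>'" for x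
    using assms(3) that by (auto simp: h_def)
  then have "inj_on h (set \<rho>')"
    using g(2) inj_on_cong [of "set \<rho>'" h g] by simp
  moreover have "h ` set \<rho> \<inter> h ` set \<rho>' = {}"
    using assms(4) unfolding h by simp
  ultimately have inj: "inj_on h (set \<rho> \<union> set \<rho>')"
    unfolding inj_on_Un by blast
  have "Subst (\<rho> @ \<rho>') (shuffle_at I \<sigma> \<sigma>') = Subst (\<tau> @ \<tau>') (shuffle_at I \<upsilon> \<upsilon>')"
    if I: "I \<in> shuffle_positions \<sigma> \<sigma>'" for I
  proof -
    have "renaming (\<rho> @ \<rho>', shuffle_at I \<sigma> \<sigma>') (\<tau> @ \<tau>', shuffle_at I \<upsilon> \<upsilon>')"
      by (rule renamingI [of _ _ h])
        (use I inj f(1) g(1) in \<open>simp_all add: h shuffle_at_map set_shuffle_at\<close>)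
    then show ?thesis
      unfolding Subst_def using Quotient_rel_abs [OF Quotient_subst] by blast
  qed
  then show ?thesis by (simp add: shuffle_sum_def h)
qed

text \<open>The letters of the two factors are made disjoint by doubling; by \<open>subst_mult_Subst\<close> below
  the choice of disjoint representatives is irrelevant.\<close>

lift_definition subst_mult :: "subst \<Rightarrow> subst \<Rightarrow> (subst \<Rightarrow>\<^sub>0 int)" is
  "\<lambda>(\<rho>, \<sigma>) (\<rho>', \<sigma>').
     shuffle_sum (map (\<lambda>x. 2 * x) \<rho>) (map (\<lambda>x. 2 * x) \<sigma>)
       (map (\<lambda>x. 2 * x + 1) \<rho>') (map (\<lambda>x. 2 * x + 1) \<sigma>')"
proof (clarify, rule shuffle_sum_renaming)
  fix \<rho> \<sigma> \<tau> \<upsilon> \<rho>' \<sigma>' \<tau>' \<upsilon>' :: word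
  assume pq: "renaming (\<rho>, \<sigma>) (\<tau>, \<upsilon>)" "renaming (\<rho>', \<sigma>') (\<tau>', \<upsilon>')"
  have r: "renaming (a, b) (map f a, map f b)" "renaming (map f a, map f b) (a, b)"
    if "set a = set b" "inj f" for a b :: word and f
  proof -
    show "renaming (a, b) (map f a, map f b)"
      by (rule renamingI [of _ _ f]) (use that in \<open>auto intro: inj_on_subset\<close>)
    then show "renaming (map f a, map f b) (a, b)" by (rule renaming_sym)
  qed
  have inj: "inj (\<lambda>x::nat. 2 * x)" "inj (\<lambda>x::nat. 2 * x + 1)" by (auto simp: inj_def)
  have eq: "set \<rho> = set \<sigma>" "set \<tau> = set \<upsilon>" "set \<rho>' = set \<sigma>'" "set \<tau>' = set \<upsilon>'"
    using pq by (auto simp: renaming_def)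
  show "renaming (map (\<lambda>x. 2 * x) \<rho>, map (\<lambda>x. 2 * x) \<sigma>) (map (\<lambda>x. 2 * x) \<tau>, map (\<lambda>x. 2 * x) \<upsilon>)"
    by (rule renaming_trans [OF r(2) [OF eq(1) inj(1)] renaming_trans [OF pq(1) r(1) [OF eq(2) inj(1)]]])
  show "renaming (map (\<lambda>x. 2 * x + 1) \<rho>', map (\<lambda>x. 2 * x + 1) \<sigma>')
      (map (\<lambda>x. 2 * x + 1) \<tau>', map (\<lambda>x. 2 * x + 1) \<upsilon>')"
    by (rule renaming_trans [OF r(2) [OF eq(3) inj(2)] renaming_trans [OF pq(2) r(1) [OF eq(4) inj(2)]]])
  show "set (map (\<lambda>x. 2 * x) \<rho>) \<inter> set (map (\<lambda>x. 2 * x + 1) \<rho>') = {}"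
    "set (map (\<lambda>x. 2 * x) \<tau>) \<inter> set (map (\<lambda>x. 2 * x + 1) \<tau>') = {}"
    by (auto, presburger+)
qed

lemma subst_mult_Subst:
  assumes "set \<rho> = set \<sigma>" "set \<rho>' = set \<sigma>'" "set \<rho> \<inter> set \<rho>' = {}"
  shows "subst_mult (Subst \<rho> \<sigma>) (Subst \<rho>' \<sigma>') =
    (\<Sum>I\<in>shuffle_positions \<sigma> \<sigma>'. frag_of (Subst (\<rho> @ \<rho>') (shuffle_at I \<sigma> \<sigma>')))"
proof -
  let ?f = "\<lambda>x::nat. 2 * x" and ?g = "\<lambda>x::nat. 2 * x + 1"
  have "subst_mult (Subst \<rho> \<sigma>) (Subst \<rho>' \<sigma>') =
      shuffle_sum (map ?f \<rho>) (map ?f \<sigma>) (map ?g \<rho>') (map ?g \<sigma>')"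
    unfolding Subst_def by (simp add: subst_mult.abs_eq renaming_refl assms)
  also have "\<dots> = shuffle_sum \<rho> \<sigma> \<rho>' \<sigma>'"
  proof (rule shuffle_sum_renaming [symmetric])
    show "renaming (\<rho>, \<sigma>) (map ?f \<rho>, map ?f \<sigma>)"
      by (rule renamingI [of _ _ ?f]) (use assms in \<open>auto simp: inj_on_def\<close>)
    show "renaming (\<rho>', \<sigma>') (map ?g \<rho>', map ?g \<sigma>')"
      by (rule renamingI [of _ _ ?g]) (use assms in \<open>auto simp: inj_on_def\<close>)
    show "set (map ?f \<rho>) \<inter> set (map ?g \<rho>') = {}"
      by (auto, presburger+)
  qed (rule assms)
  finally show ?thesis by (simp add: shuffle_sum_def)
qed

definition good_cuts :: "word \<Rightarrow> nat set" where
  "good_cuts \<sigma> = {k. k \<le> length \<sigma> \<and> set (take k \<sigma>) \<inter> set (drop k \<sigma>) = {}}"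

text \<open>The substitution with rows \<open>p\<^sup>-\<^sup>1(\<sigma>\<^sub>1)\<close> and \<open>\<sigma>\<^sub>1\<close>, where \<open>\<rho>\<close> is the first row of \<open>p\<close>.\<close>

definition subst_part :: "word \<Rightarrow> word \<Rightarrow> subst" where
  "subst_part \<rho> \<sigma>\<^sub>1 = Subst (filter (\<lambda>x. x \<in> set \<sigma>\<^sub>1) \<rho>) \<sigma>\<^sub>1"

lift_definition subst_comult :: "subst \<Rightarrow> (subst \<Rightarrow>\<^sub>0 int, subst \<Rightarrow>\<^sub>0 int) tensor" is
  "\<lambda>(\<rho>, \<sigma>). \<Sum>k\<in>good_cuts \<sigma>.
     frag_of (subst_part \<rho> (take k \<sigma>)) \<otimes>\<^sub>Z frag_of (subst_part \<rho> (drop k \<sigma>))"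
proof clarify
  fix \<rho> \<sigma> \<rho>' \<sigma>' :: word
  assume "renaming (\<rho>, \<sigma>) (\<rho>', \<sigma>')"
  then obtain f where f: "set \<rho> = set \<sigma>" "inj_on f (set \<rho>)" "\<rho>' = map f \<rho>" "\<sigma>' = map f \<sigma>"
    by (rule renamingE)
  have part: "subst_part \<rho> \<alpha> = subst_part \<rho>' (map f \<alpha>)" if "set \<alpha> \<subseteq> set \<sigma>" for \<alpha>
  proof -
    have "f x \<in> set (map f \<alpha>) \<longleftrightarrow> x \<in> set \<alpha>" if "x \<in> set \<rho>" for x
      using f \<open>set \<alpha> \<subseteq> set \<sigma>\<close> that by (auto simp: inj_on_def)
    then have "filter (\<lambda>x. x \<in> set (map f \<alpha>)) \<rho>' = map f (filter (\<lambda>x. x \<in> set \<alpha>) \<rho>)"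
      unfolding f(3) filter_map by (intro arg_cong [of _ _ "map f"] filter_cong) (simp_all only: comp_def)
    moreover have "renaming (filter (\<lambda>x. x \<in> set \<alpha>) \<rho>, \<alpha>) (map f (filter (\<lambda>x. x \<in> set \<alpha>) \<rho>), map f \<alpha>)"
      by (rule renamingI [of _ _ f]) (use f that in \<open>auto intro: inj_on_subset\<close>)
    ultimately show ?thesis
      unfolding subst_part_def Subst_def using Quotient_rel_abs [OF Quotient_subst] by metis
  qed
  have "good_cuts \<sigma>' = good_cuts \<sigma>"
  proof -
    have "set (take k \<sigma>') \<inter> set (drop k \<sigma>') = f ` (set (take k \<sigma>) \<inter> set (drop k \<sigma>))" for k
      using inj_on_image_Int [of f "set \<rho>" "set (take k \<sigma>)" "set (drop k \<sigma>)"] f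
      by (simp add: take_map drop_map set_take_subset set_drop_subset)
    then show ?thesis using f by (simp add: good_cuts_def)
  qed
  then show "(\<Sum>k\<in>good_cuts \<sigma>. frag_of (subst_part \<rho> (take k \<sigma>)) \<otimes>\<^sub>Z frag_of (subst_part \<rho> (drop k \<sigma>))) =
      (\<Sum>k\<in>good_cuts \<sigma>'. frag_of (subst_part \<rho>' (take k \<sigma>')) \<otimes>\<^sub>Z frag_of (subst_part \<rho>' (drop k \<sigma>')))"
    by (simp add: part set_take_subset set_drop_subset f(4) take_map drop_map)
qed


lemma subst_comult_Subst:
  assumes "set \<rho> = set \<sigma>"
  shows "subst_comult (Subst \<rho> \<sigma>) = (\<Sum>k\<in>good_cuts \<sigma>.
     frag_of (subst_part \<rho> (take k \<sigma>)) \<otimes>\<^sub>Z frag_of (subst_part \<rho> (drop k \<sigma>)))"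
  unfolding Subst_def by (simp add: subst_comult.abs_eq renaming_refl assms)


section \<open>The Hopf algebra of substitutions\<close>

type_synonym dWHA = "subst \<Rightarrow>\<^sub>0 int"

definition dWHA_grade :: "nat \<Rightarrow> dWHA set" where
  "dWHA_grade n = {x. \<forall>p\<in>Poly_Mapping.keys x. subst_deg p = n}"

definition dWHA_mult :: "(dWHA, dWHA) tensor \<Rightarrow> dWHA" where
  "dWHA_mult = tensor_lift (\<lambda>x y. free_lift (\<lambda>p. free_lift (\<lambda>q. subst_mult p q) y) x)"

lemma dWHA_mult_basis: "dWHA_mult (frag_of p \<otimes>\<^sub>Z frag_of q) = subst_mult p q"
proof -
  have "biadditive (\<lambda>x y. free_lift (\<lambda>p. free_lift (\<lambda>q. subst_mult p q) y) x)"
    by (rule biadditiveI)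
      (simp_all add: additive_def free_lift_add free_lift_fun_add)
  then show ?thesis by (simp add: dWHA_mult_def tensor_lift_tens)
qed

definition dWHA_unit :: "int \<Rightarrow> dWHA" where
  "dWHA_unit k = frag_cmul k (frag_of empty_subst)"

definition dWHA_comult :: "dWHA \<Rightarrow> (dWHA, dWHA) tensor" where
  "dWHA_comult = free_lift subst_comult"

definition dWHA_counit :: "dWHA \<Rightarrow> int" where
  "dWHA_counit = free_lift (\<lambda>p. if p = empty_subst then 1 else 0)"

end

theory Submission
  imports Defs
begin

text \<open>Cutting a shuffle of two words is the same as cutting both words and shuffling the left parts
  and the right parts separately; as the two words have disjoint supports, the cut of the shuffle is
  good iff both cuts are. This makes the comultiplication multiplicative. Associativity is that of
  the shuffle product, coassociativity that of deconcatenation. The antipode exists in every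
  connected graded bialgebra: the convolution powers of \<open>J = id - e \<circ> \<epsilon>\<close> vanish in degrees below the
  exponent, so the geometric series \<open>\<Sum>i. (-1)\<^sup>i J\<^sup>*\<^sup>i\<close> is a finite sum on every element and inverts
  \<open>id\<close> with respect to convolution.\<close>


section \<open>Additive maps on tensor products\<close>

text \<open>The defining sums run over position sets and cut indices, which resist induction, and
  their summands live in quotients: renaming classes in the basis, bilinearity classes in the
  tensors. Each sum is therefore replaced by a recursion on words that takes the summand as a
  function (\<open>shuffle_add\<close>, \<open>cut_add\<close>). Nesting them expresses iterated
  products and coproducts with multiplicities, and additive maps move inside them, so on
  representatives with disjoint supports the associativity, coassociativity and compatibility laws
  become identities about plain words. Goodness of a cut depends on the whole word and does not fit
  a recursion on the first letter; so all cuts are kept and the bad ones get the summand 0. In the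
  antipode argument the obstacle is that the number of nonzero terms of the series depends on the
  element. Identities are proved for partial sums and then transferred, which for
  \<open>tensor_map\<close> requires one bound that serves a whole tensor.\<close>

lemma additive_id: "additive id"
  by (simp add: additive_def)

lemma additive_comp: "additive f \<Longrightarrow> additive g \<Longrightarrow> additive (f \<circ> g)"
  by (simp add: additive_def)

lemma additive_minus_fun: "additive f \<Longrightarrow> additive g \<Longrightarrow> additive (\<lambda>x. f x - g x)"
  by (simp add: additive_def algebra_simps)

lemma additive_tensor_map: "additive f \<Longrightarrow> additive g \<Longrightarrow> additive (tensor_map f g)"
  unfolding tensor_map_def by (intro additive_tensor_lift biadditive_tens)

lemma additive_tensor_assoc: "additive tensor_assoc"
  unfolding tensor_assoc_def by (intro additive_tensor_lift biadditive_tensor_assoc)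

lemma additive_tensor_interchange: "additive tensor_interchange"
  unfolding tensor_interchange_def by (intro additive_tensor_lift biadditive_tensor_interchange)

lemma additive_tensor_lunit: "additive tensor_lunit"
  unfolding tensor_lunit_def
  by (intro additive_tensor_lift) (simp add: biadditive_def additive_def zscale_add_left zscale_add_right)

lemma additive_tensor_runit: "additive tensor_runit"
  unfolding tensor_runit_def
  by (intro additive_tensor_lift) (simp add: biadditive_def additive_def zscale_add_left zscale_add_right)

lemma additive_tens_right: "additive (\<lambda>y. x \<otimes>\<^sub>Z y)"
  by (simp add: additive_def tens_add_right)

lemma additive_tens_left: "additive (\<lambda>x. x \<otimes>\<^sub>Z y)"
  by (simp add: additive_def tens_add_left)

lemma tens_zero_left [simp]: "0 \<otimes>\<^sub>Z y = 0"
  by (rule additive.zero [OF additive_tens_left])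

lemma tens_zero_right [simp]: "x \<otimes>\<^sub>Z 0 = 0"
  by (rule additive.zero [OF additive_tens_right])

lemma additive_zscale:
  assumes "additive f"
  shows "f (zscale k x) = zscale k (f x)"
proof -
  interpret additive f by fact
  show ?thesis by (simp add: zscale_def diff sum)
qed

lemma additive_tensor_ext:
  assumes "additive f" "additive g" "\<And>a b. f (a \<otimes>\<^sub>Z b) = g (a \<otimes>\<^sub>Z b)"
  shows "f = g"
  using additive_eqI [OF assms] by (rule ext)

lemma additive_tensor3_ext:
  assumes "additive f" "additive g" "\<And>a b c. f ((a \<otimes>\<^sub>Z b) \<otimes>\<^sub>Z c) = g ((a \<otimes>\<^sub>Z b) \<otimes>\<^sub>Z c)"
  shows "f = g"
proof (rule additive_tensor_ext [OF assms(1,2)])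
  fix s c
  have "f \<circ> (\<lambda>s. s \<otimes>\<^sub>Z c) = g \<circ> (\<lambda>s. s \<otimes>\<^sub>Z c)"
    by (rule additive_tensor_ext) ((intro additive_comp assms(1,2) additive_tens_left; fail) | simp add: assms(3))+
  then show "f (s \<otimes>\<^sub>Z c) = g (s \<otimes>\<^sub>Z c)" by (simp add: fun_eq_iff)
qed

lemma tensor_map_comp:
  assumes "additive f" "additive g" "additive f'" "additive g'"
  shows "tensor_map f g (tensor_map f' g' t) = tensor_map (f \<circ> f') (g \<circ> g') t"
proof -
  have "tensor_map f g \<circ> tensor_map f' g' = tensor_map (f \<circ> f') (g \<circ> g')"
  proof (rule additive_tensor_ext)
    show "additive (tensor_map f g \<circ> tensor_map f' g')" "additive (tensor_map (f \<circ> f') (g \<circ> g'))"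
      by (intro additive_comp additive_tensor_map assms)+
    show "(tensor_map f g \<circ> tensor_map f' g') (a \<otimes>\<^sub>Z b) = tensor_map (f \<circ> f') (g \<circ> g') (a \<otimes>\<^sub>Z b)" for a b
      by (simp add: tensor_map_tens assms additive_comp)
  qed
  then show ?thesis by (simp add: fun_eq_iff)
qed

lemma tensor_assoc_natural:
  assumes "additive f" "additive g" "additive h"
  shows "tensor_map f (tensor_map g h) (tensor_assoc t) = tensor_assoc (tensor_map (tensor_map f g) h t)"
proof -
  have "tensor_map f (tensor_map g h) \<circ> tensor_assoc = tensor_assoc \<circ> tensor_map (tensor_map f g) h"
    by (rule additive_tensor3_ext)
      ((intro additive_comp additive_tensor_map additive_tensor_assoc assms; fail)
        | simp add: assms additive_tensor_map tensor_map_tens tensor_assoc_tens)+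
  then show ?thesis by (simp add: fun_eq_iff)
qed

lemma tensor_lunit_natural:
  assumes "additive f"
  shows "tensor_lunit (tensor_map id f t) = f (tensor_lunit t)"
proof -
  have "tensor_lunit \<circ> tensor_map id f = f \<circ> tensor_lunit"
    by (rule additive_tensor_ext)
      ((intro additive_comp additive_tensor_map additive_id additive_tensor_lunit assms; fail)
        | simp add: assms additive_id tensor_map_tens tensor_lunit_tens additive_zscale)+
  then show ?thesis by (simp add: fun_eq_iff)
qed

lemma tensor_runit_natural:
  assumes "additive f"
  shows "tensor_runit (tensor_map f id t) = f (tensor_runit t)"
proof -
  have "tensor_runit \<circ> tensor_map f id = f \<circ> tensor_runit"
    by (rule additive_tensor_ext)
      ((intro additive_comp additive_tensor_map additive_id additive_tensor_runit assms; fail)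
        | simp add: assms additive_id tensor_map_tens tensor_runit_tens additive_zscale)+
  then show ?thesis by (simp add: fun_eq_iff)
qed

lemma additive_add_fun: "additive f \<Longrightarrow> additive g \<Longrightarrow> additive (\<lambda>x. f x + g x)"
  by (simp add: additive_def algebra_simps)

lemma tensor_map_add_left:
  assumes "additive f" "additive f'" "additive g"
  shows "tensor_map (\<lambda>x. f x + f' x) g t = tensor_map f g t + tensor_map f' g t"
proof -
  have "tensor_map (\<lambda>x. f x + f' x) g = (\<lambda>t. tensor_map f g t + tensor_map f' g t)"
    by (rule additive_tensor_ext)
      ((intro additive_add_fun additive_tensor_map assms; fail)
        | simp add: tensor_map_tens additive_add_fun assms tens_add_left)+
  then show ?thesis by simp
qed

lemma tensor_map_add_right:
  assumes "additive f" "additive g" "additive g'"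
  shows "tensor_map f (\<lambda>x. g x + g' x) t = tensor_map f g t + tensor_map f g' t"
proof -
  have "tensor_map f (\<lambda>x. g x + g' x) = (\<lambda>t. tensor_map f g t + tensor_map f g' t)"
    by (rule additive_tensor_ext)
      ((intro additive_add_fun additive_tensor_map assms; fail)
        | simp add: tensor_map_tens additive_add_fun assms tens_add_right)+
  then show ?thesis by simp
qed

text \<open>Because \<open>tensor_grade\<close> is a generated subgroup, degrees of tensors need to
  be checked only on pure tensors of homogeneous elements. Taking \<open>B = {0}\<close> turns this
  into a vanishing criterion.\<close>

lemma group_closure_additive_image:
  assumes "additive f" "t \<in> group_closure X" "\<And>x. x \<in> X \<Longrightarrow> f x \<in> B"
    and "0 \<in> B" "\<And>x y. x \<in> B \<Longrightarrow> y \<in> B \<Longrightarrow> x - y \<in> B"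
  shows "f t \<in> B"
proof -
  interpret additive f by fact
  from assms(2) show ?thesis
    by induction (use assms(3-5) in \<open>auto simp: zero diff\<close>)
qed

lemma tensor_map_tensor_grade:
  assumes "additive f" "additive g" "\<And>n. f ` A n \<subseteq> A n" "\<And>n. g ` A n \<subseteq> A n"
    and "t \<in> tensor_grade A n"
  shows "tensor_map f g t \<in> tensor_grade A n"
  unfolding tensor_grade_def
proof (rule group_closure_additive_image [OF additive_tensor_map [OF assms(1,2)]
      assms(5) [unfolded tensor_grade_def]])
  fix x assume "x \<in> {a \<otimes>\<^sub>Z b |a b i j. a \<in> A i \<and> b \<in> A j \<and> i + j = n}"
  then obtain a b i j where "x = a \<otimes>\<^sub>Z b" "a \<in> A i" "b \<in> A j" "i + j = n" by blast
  then have "tensor_map f g x = f a \<otimes>\<^sub>Z g b" "f a \<in> A i" "g b \<in> A j"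
    using assms(1,2) assms(3) [of i] assms(4) [of j] by (auto simp: tensor_map_tens)
  then have "tensor_map f g x \<in> {a \<otimes>\<^sub>Z b |a b i j. a \<in> A i \<and> b \<in> A j \<and> i + j = n}"
    using \<open>i + j = n\<close> by blast
  then show "tensor_map f g x \<in> group_closure {a \<otimes>\<^sub>Z b |a b i j. a \<in> A i \<and> b \<in> A j \<and> i + j = n}"
    by (simp add: group_closure.base)
qed (auto intro: group_closure.diff)


section \<open>The antipode of a connected graded bialgebra\<close>

definition convolution ::
    "(('a::ab_group_add, 'a) tensor \<Rightarrow> 'a) \<Rightarrow> ('a \<Rightarrow> ('a, 'a) tensor) \<Rightarrow>
     ('a \<Rightarrow> 'a) \<Rightarrow> ('a \<Rightarrow> 'a) \<Rightarrow> 'a \<Rightarrow> 'a" where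
  "convolution m \<mu> f g = m \<circ> tensor_map f g \<circ> \<mu>"

text \<open>The zeroth power is passed in as \<open>u\<close> because the convolution unit is built
  from unit and counit, which are not arguments here; it is instantiated with
  \<open>e \<circ> \<epsilon>\<close>.\<close>

primrec convolution_power ::
    "(('a::ab_group_add, 'a) tensor \<Rightarrow> 'a) \<Rightarrow> ('a \<Rightarrow> ('a, 'a) tensor) \<Rightarrow>
     ('a \<Rightarrow> 'a) \<Rightarrow> ('a \<Rightarrow> 'a) \<Rightarrow> nat \<Rightarrow> 'a \<Rightarrow> 'a" where
  "convolution_power m \<mu> u f 0 = u"
| "convolution_power m \<mu> u f (Suc n) = convolution m \<mu> (convolution_power m \<mu> u f n) f"

text \<open>Convolution makes the additive endomorphisms a ring with unit \<open>\<eta>\<close>, in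
  which \<open>id = \<eta> + J\<close>. The series inverting \<open>id\<close> is finite only
  pointwise, so additivity and the antipode equations are read off from the partial sums
  \<open>T N\<close> with \<open>N\<close> large enough for the argument at hand.\<close>

lemma connected_graded_bialgebra_antipode:
  fixes A :: "nat \<Rightarrow> 'a::ab_group_add set"
  assumes "connected_graded_bialgebra A m e \<mu> \<epsilon>"
  shows "\<exists>S. connected_graded_Hopf_algebra A m e \<mu> \<epsilon> S"
proof -
  have m: "additive m" and e: "additive e"
    and m_assoc: "m (tensor_map m id t) = m (tensor_map id m (tensor_assoc t))"
    and m_lunit: "m (tensor_map e id s) = tensor_lunit s"
    and m_runit: "m (tensor_map id e s') = tensor_runit s'" for t s s'
    using assms
    by (auto simp: connected_graded_bialgebra_def graded_bialgebra_def bialgebra_def algebra_def fun_eq_iff)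
  have \<mu>: "additive \<mu>" and \<epsilon>: "additive \<epsilon>"
    and \<mu>_coassoc: "tensor_assoc (tensor_map \<mu> id (\<mu> x)) = tensor_map id \<mu> (\<mu> x)"
    and \<mu>_lunit: "tensor_lunit (tensor_map \<epsilon> id (\<mu> x)) = x"
    and \<mu>_runit: "tensor_runit (tensor_map id \<epsilon> (\<mu> x)) = x"
    and \<epsilon>_e: "\<epsilon> (e k) = k" for x k
    using assms
    by (auto simp: connected_graded_bialgebra_def graded_bialgebra_def bialgebra_def coalgebra_def
        coalgebra_hom_def fun_eq_iff)
  have grading: "grading A" and m_grade: "t \<in> tensor_grade A n \<Longrightarrow> m t \<in> A n"
    and \<mu>_grade: "x \<in> A n \<Longrightarrow> \<mu> x \<in> tensor_grade A n"
    and \<epsilon>_grade: "x \<in> A n \<Longrightarrow> n > 0 \<Longrightarrow> \<epsilon> x = 0" and e_surj: "A 0 = range e" for t x n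
    using assms
    unfolding connected_graded_bialgebra_def graded_bialgebra_def bij_betw_def
    by (simp_all add: image_subset_iff)
  have A_zero: "0 \<in> A n" and A_diff: "x \<in> A n \<Longrightarrow> y \<in> A n \<Longrightarrow> x - y \<in> A n" for n x y
    using grading by (auto simp: grading_def)
  let ?conv = "convolution m \<mu>"
  define \<eta> where "\<eta> = e \<circ> \<epsilon>"
  have \<eta>: "additive \<eta>" unfolding \<eta>_def by (intro additive_comp e \<epsilon>)
  have conv: "additive (?conv f g)" if "additive f" "additive g" for f g
    unfolding convolution_def using that by (intro additive_comp additive_tensor_map m \<mu>)
  have conv_assoc: "?conv (?conv f g) h = ?conv f (?conv g h)"
    if fgh: "additive f" "additive g" "additive h" for f g h
  proof
    fix x
    note adds = fgh m \<mu> additive_id additive_tensor_map additive_comp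
    \<comment> \<open>Both bracketings are brought to a threefold form: associativity of
      \<open>m\<close> acts outside, naturality of \<open>tensor_assoc\<close> moves the bracket
      past the three maps, and coassociativity of \<open>\<mu>\<close> acts inside.\<close>
    have "?conv (?conv f g) h x = m (tensor_map m id (tensor_map (tensor_map f g) h (tensor_map \<mu> id (\<mu> x))))"
      by (simp add: convolution_def tensor_map_comp adds comp_assoc)
    also have "\<dots> = m (tensor_map id m (tensor_map f (tensor_map g h) (tensor_assoc (tensor_map \<mu> id (\<mu> x)))))"
      by (simp add: m_assoc tensor_assoc_natural adds)
    also have "\<dots> = ?conv f (?conv g h) x"
      by (simp add: convolution_def \<mu>_coassoc tensor_map_comp adds comp_assoc)
    finally show "?conv (?conv f g) h x = ?conv f (?conv g h) x" .
  qed
  have conv_u_right: "?conv f \<eta> = f" if f: "additive f" for f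
  proof
    fix x
    note adds = f e \<epsilon> additive_id
    \<comment> \<open>Factoring \<open>\<eta>\<close> puts the counit next to \<open>\<mu> x\<close>
      and the unit next to \<open>m\<close>, so that one unit law applies at each end.\<close>
    have "tensor_map f \<eta> (\<mu> x) = tensor_map id e (tensor_map f id (tensor_map id \<epsilon> (\<mu> x)))"
      by (simp add: \<eta>_def tensor_map_comp adds additive_comp additive_tensor_map)
    then show "?conv f \<eta> x = f x"
      by (simp add: convolution_def m_runit tensor_runit_natural f \<mu>_runit)
  qed
  have conv_u_left: "?conv \<eta> f = f" if f: "additive f" for f
  proof
    fix x
    note adds = f e \<epsilon> additive_id
    have "tensor_map \<eta> f (\<mu> x) = tensor_map e id (tensor_map id f (tensor_map \<epsilon> id (\<mu> x)))"
      by (simp add: \<eta>_def tensor_map_comp adds additive_comp additive_tensor_map)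
    then show "?conv \<eta> f x = f x"
      by (simp add: convolution_def m_lunit tensor_lunit_natural f \<mu>_lunit)
  qed
  have conv_add_left: "?conv (\<lambda>x. f x + f' x) g x = ?conv f g x + ?conv f' g x"
    and conv_add_right: "?conv g (\<lambda>x. f x + f' x) x = ?conv g f x + ?conv g f' x"
    if "additive f" "additive f'" "additive g" for f f' g x
    using that additive.add [OF m]
    by (simp_all add: convolution_def tensor_map_add_left tensor_map_add_right)

  define J where "J = (\<lambda>x. x - \<eta> x)"
  have J: "additive J"
    unfolding J_def using additive_minus_fun [OF additive_id \<eta>] by (simp add: comp_def)
  have id_split: "id = (\<lambda>x. \<eta> x + J x)" by (simp add: J_def fun_eq_iff)
  \<comment> \<open>Connectedness enters here: an element of degree 0 has the form
    \<open>e k\<close>, and \<open>\<epsilon> (e k) = k\<close> makes \<open>\<eta>\<close> fix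
    it.\<close>
  have J_0: "J x = 0" if "x \<in> A 0" for x
    using that by (auto simp: J_def \<eta>_def e_surj \<epsilon>_e)
  have J_grade: "J ` A n \<subseteq> A n" for n
  proof (cases "n = 0")
    case True then show ?thesis using J_0 A_zero by auto
  next
    case False then show ?thesis using additive.zero [OF e] by (auto simp: J_def \<eta>_def \<epsilon>_grade)
  qed
  let ?P = "convolution_power m \<mu> \<eta> J"
  have P: "additive (?P n)" for n
    by (induction n) (simp_all only: convolution_power.simps \<eta> conv J)
  \<comment> \<open>The powers are defined by appending \<open>J\<close> on the right; this form is
    needed to show that the series is also a right inverse of \<open>id\<close>.\<close>
  have P_comm: "?conv J (?P n) = ?P (Suc n)" for n
  proof (induction n)
    case 0 show ?case by (simp add: conv_u_left conv_u_right J)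
  next
    case (Suc n)
    have "?conv J (?P (Suc n)) = ?conv (?conv J (?P n)) J" by (simp add: conv_assoc J P)
    then show ?case using Suc by simp
  qed
  have P_0: "?P i x = 0" if "x \<in> A n" "n < i" for i n x
    using that
  proof (induction i arbitrary: n x)
    case (Suc i)
    have "tensor_map (?P i) J (\<mu> x) \<in> {0}"
    proof (rule group_closure_additive_image [OF additive_tensor_map [OF P J]])
      show "\<mu> x \<in> group_closure {a \<otimes>\<^sub>Z b |a b i j. a \<in> A i \<and> b \<in> A j \<and> i + j = n}"
        using \<mu>_grade [OF Suc.prems(1)] by (simp add: tensor_grade_def)
    next
      fix t assume "t \<in> {a \<otimes>\<^sub>Z b |a b i j. a \<in> A i \<and> b \<in> A j \<and> i + j = n}"
      then obtain a b k j where t: "t = a \<otimes>\<^sub>Z b" "a \<in> A k" "b \<in> A j" "k + j = n" by blast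
      \<comment> \<open>If \<open>j = 0\<close>, then \<open>J\<close> kills \<open>b\<close>.
        Otherwise \<open>k < n \<le> i\<close>, and the induction hypothesis kills
        \<open>a\<close>.\<close>
      then have "?P i a = 0 \<or> J b = 0"
        using Suc.IH [of a k] J_0 [of b] Suc.prems(2) by (cases "j = 0") auto
      then show "tensor_map (?P i) J t \<in> {0}"
        by (auto simp: t(1) tensor_map_tens P J)
    qed auto
    then show ?case using additive.zero [OF m] by (simp add: convolution_def)
  qed simp
  have P_ev: "\<exists>N. \<forall>i\<ge>N. ?P i x = 0" for x
  proof -
    obtain c where c: "finite {n. c n \<noteq> 0}" "\<And>n. c n \<in> A n" "x = (\<Sum>n | c n \<noteq> 0. c n)"
      using grading unfolding grading_def by metis
    \<comment> \<open>Any bound above all degrees occurring in \<open>x\<close> works, since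
      \<open>P_0\<close> then applies to every homogeneous component.\<close>
    obtain N where N: "\<forall>n\<in>{n. c n \<noteq> 0}. n < N"
      using c(1) finite_nat_set_iff_bounded by blast
    have "?P i x = 0" if "i \<ge> N" for i
    proof -
      have "?P i (c n) = 0" if "c n \<noteq> 0" for n
        using N that \<open>i \<ge> N\<close> by (intro P_0 [OF c(2)]) (auto intro: less_le_trans)
      then have "(\<Sum>n | c n \<noteq> 0. ?P i (c n)) = 0" by (intro sum.neutral) auto
      then show ?thesis using c(3) by (simp only: additive.sum [OF P])
    qed
    then show ?thesis by blast
  qed
  have P_grade: "?P i ` A n \<subseteq> A n" for i n
  proof (induction i arbitrary: n)
    case 0
    have "\<eta> x \<in> A n" if "x \<in> A n" for x
      using A_diff [OF that, of "J x"] J_grade [of n] that by (auto simp: J_def)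
    then show ?case by auto
  next
    case (Suc i)
    then show ?case
      using tensor_map_tensor_grade [OF P J Suc J_grade] m_grade \<mu>_grade
      by (auto simp: convolution_def)
  qed

  \<comment> \<open>The signed term of the geometric series; the sign is given by parity because the
    ambient type is only an abelian group.\<close>
  define Q where "Q = (\<lambda>i x. if even i then ?P i x else - ?P i x)"
  have Q: "additive (Q i)" for i
    using P [of i] by (auto simp: Q_def additive_def)
  define T where "T = (\<lambda>N x. \<Sum>i<N. Q i x)"
  \<comment> \<open>The index set is finite by \<open>P_ev\<close>, but it varies with
    \<open>x\<close>, so additivity of \<open>S\<close> is not immediate.\<close>
  define S where "S = (\<lambda>x. \<Sum>i | ?P i x \<noteq> 0. Q i x)"
  have T: "additive (T N)" for N
    using Q by (simp add: T_def additive_def sum.distrib)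
  have T_Suc: "T (Suc N) = (\<lambda>x. T N x + Q N x)" for N by (simp add: T_def fun_eq_iff)
  have S_T: "S x = T N x" if "\<forall>i\<ge>N. ?P i x = 0" for N x
    unfolding S_def T_def
    by (rule sum.mono_neutral_left) (use that in \<open>auto simp: Q_def not_less\<close>, meson not_less)
  have S_ev: "\<exists>N. \<forall>n\<ge>N. S x = T n x" for x
    using P_ev [of x] S_T by (meson order_trans)
  have S: "additive S"
  proof
    fix x y
    obtain N where N: "\<forall>n\<ge>N. S x = T n x" using S_ev by blast
    obtain N' where N': "\<forall>n\<ge>N'. S y = T n y" using S_ev by blast
    obtain N'' where N'': "\<forall>n\<ge>N''. S (x + y) = T n (x + y)" using S_ev by blast
    \<comment> \<open>One partial sum has to represent \<open>S\<close> at \<open>x\<close>, at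
      \<open>y\<close> and at \<open>x + y\<close> simultaneously.\<close>
    let ?n = "max N (max N' N'')"
    have "S x = T ?n x" "S y = T ?n y" "S (x + y) = T ?n (x + y)" using N N' N'' by auto
    then show "S (x + y) = S x + S y" using additive.add [OF T] by metis
  qed
  have conv_zero: "?conv (\<lambda>x. 0) g x = 0" "?conv g (\<lambda>x. 0) x = 0" if "additive g" for g x
  proof -
    have z: "additive (\<lambda>x::'a. 0::'a)" by (simp add: additive_def)
    show "?conv (\<lambda>x. 0) g x = 0" "?conv g (\<lambda>x. 0) x = 0"
      using conv_add_left [OF z z that, of x] conv_add_right [OF z z that, of x] by simp_all
  qed
  have conv_uminus: "?conv (\<lambda>x. - f x) g x = - ?conv f g x" "?conv g (\<lambda>x. - f x) x = - ?conv g f x"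
    if "additive f" "additive g" for f g x
  proof -
    have f': "additive (\<lambda>x. - f x)" using that by (simp add: additive_def)
    show "?conv (\<lambda>x. - f x) g x = - ?conv f g x" "?conv g (\<lambda>x. - f x) x = - ?conv g f x"
      using conv_add_left [OF that(1) f' that(2), of x] conv_add_right [OF that(1) f' that(2), of x]
      by (simp_all add: conv_zero that eq_neg_iff_add_eq_0 add.commute)
  qed
  have Q_J: "?conv (Q i) J x = - Q (Suc i) x" "?conv J (Q i) x = - Q (Suc i) x" for i x
    using P_comm [of i]
    by (auto simp: Q_def conv_uminus P J cong: if_cong)
  have T_id: "?conv (T N) id x = \<eta> x - Q N x" and id_T: "?conv id (T N) x = \<eta> x - Q N x" for N x
  proof -
    \<comment> \<open>Multiplying by \<open>id = \<eta> + J\<close> gives consecutive differences,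
      because convolving with \<open>J\<close> raises the exponent and flips the sign. Summation
      telescopes to \<open>Q 0 - Q N\<close>, and \<open>Q 0 = \<eta>\<close>.\<close>
    have "?conv (Q i) id x = Q i x - Q (Suc i) x" "?conv id (Q i) x = Q i x - Q (Suc i) x" for i
      unfolding id_split
      by (simp_all only: conv_add_left conv_add_right \<eta> J Q Q_J conv_u_left conv_u_right) simp_all
    note Qid = this
    have T_0: "T 0 = (\<lambda>x. 0)" by (simp add: T_def)
    show "?conv (T N) id x = \<eta> x - Q N x"
    proof (induction N)
      case 0
      show ?case unfolding T_0 conv_zero [OF additive_id] by (simp add: Q_def)
    next
      case (Suc N)
      then show ?case unfolding T_Suc by (simp only: conv_add_left T Q additive_id Qid) simp
    qed
    show "?conv id (T N) x = \<eta> x - Q N x"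
    proof (induction N)
      case 0
      show ?case unfolding T_0 conv_zero [OF additive_id] by (simp add: Q_def)
    next
      case (Suc N)
      then show ?case unfolding T_Suc by (simp only: conv_add_right T Q additive_id Qid) simp
    qed
  qed
  \<comment> \<open>Pointwise agreement of \<open>S\<close> with partial sums does not by itself
    pass through \<open>tensor_map\<close>. A tensor is built from finitely many pure tensors, so
    bounds for these combine by \<open>max\<close>.\<close>
  have ev: "\<exists>N. \<forall>n\<ge>N. tensor_map S g t = tensor_map (T n) g t \<and> tensor_map g S t = tensor_map g (T n) t"
    if g: "additive g" for g :: "'a \<Rightarrow> 'a" and t
  proof (induction t rule: tensor_induct)
    case zero
    show ?case
      using additive.zero [OF additive_tensor_map] by (metis S T g)
  next
    case (tens a b)
    obtain N where N: "\<forall>n\<ge>N. S a = T n a" using S_ev by blast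
    obtain N' where N': "\<forall>n\<ge>N'. S b = T n b" using S_ev by blast
    show ?case
      by (rule exI [of _ "max N N'"]) (use N N' in \<open>auto simp: tensor_map_tens S T g\<close>)
  next
    case (diff s t)
    obtain N where N: "\<forall>n\<ge>N. tensor_map S g s = tensor_map (T n) g s \<and> tensor_map g S s = tensor_map g (T n) s"
      using diff by blast
    obtain N' where N': "\<forall>n\<ge>N'. tensor_map S g t = tensor_map (T n) g t \<and> tensor_map g S t = tensor_map g (T n) t"
      using diff by blast
    show ?case
      by (rule exI [of _ "max N N'"])
        (use N N' in \<open>auto simp: additive.diff [OF additive_tensor_map] S T g\<close>)
  qed
  have "?conv S id x = \<eta> x \<and> ?conv id S x = \<eta> x" for x
  proof -
    obtain N where N: "\<forall>n\<ge>N. tensor_map S id (\<mu> x) = tensor_map (T n) id (\<mu> x) \<and>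
        tensor_map id S (\<mu> x) = tensor_map id (T n) (\<mu> x)" using ev [OF additive_id] by blast
    obtain N' where N': "\<forall>i\<ge>N'. ?P i x = 0" using P_ev by blast
    define n where "n = max N N'"
    have "tensor_map S id (\<mu> x) = tensor_map (T n) id (\<mu> x)"
      "tensor_map id S (\<mu> x) = tensor_map id (T n) (\<mu> x)"
      using N by (simp_all only: n_def max.cobounded1)
    then have "?conv S id x = ?conv (T n) id x" "?conv id S x = ?conv id (T n) x"
      by (simp_all only: convolution_def comp_apply)
    moreover have "Q n x = 0" using N' by (simp add: n_def Q_def)
    ultimately show ?thesis by (simp only: T_id id_T) simp
  qed
  then have "?conv S id = \<eta>" "?conv id S = \<eta>" by blast+
  then have "antipode m e \<mu> \<epsilon> S"
    by (simp only: antipode_def S convolution_def \<eta>_def simp_thms)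
  moreover have "S ` A n \<subseteq> A n" for n
  proof
    fix y assume "y \<in> S ` A n"
    then obtain x where x: "x \<in> A n" "y = S x" by blast
    have A_add: "a + b \<in> A n" if "a \<in> A n" "b \<in> A n" for a b
      using A_diff [OF that(1) A_diff [OF A_zero that(2)]] by simp
    have "Q i x \<in> A n" for i
      using P_grade [of i n] x A_diff [OF A_zero, of "?P i x"] by (auto simp: Q_def)
    then have "T N x \<in> A n" for N
      by (induction N) (simp_all add: T_def A_zero A_add)
    moreover obtain N where "S x = T N x" using S_ev [of x] by blast
    ultimately show "y \<in> A n" using x by simp
  qed
  ultimately show ?thesis
    using assms by (auto simp: connected_graded_Hopf_algebra_def)
qed


section \<open>Sums over shuffles and over deconcatenations\<close>

text \<open>The shuffle product applied to a summand \<open>F\<close>, so that repeated shuffles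
  count repeatedly. Values in any commutative monoid are allowed, which lets the same recursion
  serve \<open>dWHA\<close>, tensors and integers.\<close>

fun shuffle_add :: "'a list \<Rightarrow> 'a list \<Rightarrow> ('a list \<Rightarrow> 'b::comm_monoid_add) \<Rightarrow> 'b" where
  "shuffle_add [] v F = F v"
| "shuffle_add (a # u) [] F = F (a # u)"
| "shuffle_add (a # u) (b # v) F =
     shuffle_add u (b # v) (\<lambda>w. F (a # w)) + shuffle_add (a # u) v (\<lambda>w. F (b # w))"

lemma shuffle_add_Nil_right [simp]: "shuffle_add u [] F = F u"
  by (cases u) auto

text \<open>Every shuffle has exactly the letters of both words. This support condition is what
  makes \<open>Subst (\<rho> @ \<rho>') w\<close> a genuine substitution, hence the restricted
  premise.\<close>

lemma shuffle_add_cong: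
  assumes "\<And>w. set w = set u \<union> set v \<Longrightarrow> F w = G w"
  shows "shuffle_add u v F = shuffle_add u v G"
  using assms
proof (induction u v F arbitrary: G rule: shuffle_add.induct)
  case (3 a u b v F)
  have "shuffle_add u (b # v) (\<lambda>w. F (a # w)) = shuffle_add u (b # v) (\<lambda>w. G (a # w))"
    by (rule 3(1)) (auto intro!: 3(3))
  moreover have "shuffle_add (a # u) v (\<lambda>w. F (b # w)) = shuffle_add (a # u) v (\<lambda>w. G (b # w))"
    by (rule 3(2)) (auto intro!: 3(3))
  ultimately show ?case by simp
qed auto

lemma shuffle_add_distrib:
  "shuffle_add u v (\<lambda>w. F w + G w) = shuffle_add u v F + shuffle_add u v G"
proof (induction u v F arbitrary: G rule: shuffle_add.induct)
  case (3 a u b v F)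
  then show ?case by (simp only: shuffle_add.simps 3) (simp only: ac_simps)
qed simp_all

lemma shuffle_add_zero [simp]: "shuffle_add u v (\<lambda>w. 0 :: 'b::comm_monoid_add) = 0"
  by (induction u v "\<lambda>_::'a list. 0::'b" rule: shuffle_add.induct) simp_all

lemma additive_shuffle_add:
  assumes "additive f"
  shows "f (shuffle_add u v F) = shuffle_add u v (\<lambda>w. f (F w))"
  by (induction u v F rule: shuffle_add.induct) (simp_all add: additive.add [OF assms])

text \<open>When no word is empty, both sides split into three sums according to which word supplies
  the first letter. Different words shrink in the three cases, so the induction is on the total
  length.\<close>

lemma shuffle_add_assoc:
  "shuffle_add u v (\<lambda>w. shuffle_add w z F) = shuffle_add v z (\<lambda>w. shuffle_add u w F)"
proof (induction "length u + length v + length z" arbitrary: u v z F rule: less_induct)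
  case less
  show ?case
  proof (cases "u = [] \<or> v = [] \<or> z = []")
    case True then show ?thesis by auto
  next
    case False
    then obtain a u' b v' c z' where uvz: "u = a # u'" "v = b # v'" "z = c # z'"
      by (metis neq_Nil_conv)
    have "shuffle_add u v (\<lambda>w. shuffle_add w z F) =
        shuffle_add u' v (\<lambda>w. shuffle_add w z (\<lambda>x. F (a # x))) +
        shuffle_add u v' (\<lambda>w. shuffle_add w z (\<lambda>x. F (b # x))) +
        shuffle_add u v (\<lambda>w. shuffle_add w z' (\<lambda>x. F (c # x)))"
      by (simp add: uvz shuffle_add_distrib algebra_simps)
    also have "\<dots> = shuffle_add v z (\<lambda>w. shuffle_add u' w (\<lambda>x. F (a # x))) +
        shuffle_add v' z (\<lambda>w. shuffle_add u w (\<lambda>x. F (b # x))) +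
        shuffle_add v z' (\<lambda>w. shuffle_add u w (\<lambda>x. F (c # x)))"
      by (intro arg_cong2 [of _ _ _ _ "(+)"] less) (simp_all add: uvz)
    also have "\<dots> = shuffle_add v z (\<lambda>w. shuffle_add u w F)"
      by (simp add: uvz shuffle_add_distrib algebra_simps)
    finally show ?thesis .
  qed
qed

text \<open>Deconcatenation with a summand: all cuts are enumerated, good or not. The first summand
  is the cut before the first letter; in all other cuts that letter belongs to the left
  part.\<close>

fun cut_add :: "'a list \<Rightarrow> ('a list \<Rightarrow> 'a list \<Rightarrow> 'b::comm_monoid_add) \<Rightarrow> 'b" where
  "cut_add [] F = F [] []"
| "cut_add (a # w) F = F [] (a # w) + cut_add w (\<lambda>x. F (a # x))"

lemma cut_add_cong:
  assumes "\<And>x y. x @ y = w \<Longrightarrow> F x y = G x y"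
  shows "cut_add w F = cut_add w G"
  using assms by (induction w F arbitrary: G rule: cut_add.induct) (auto intro!: arg_cong2 [of _ _ _ _ "(+)"])

lemma cut_add_distrib: "cut_add w (\<lambda>x y. F x y + G x y) = cut_add w F + cut_add w G"
proof (induction w arbitrary: F G)
  case (Cons a w)
  show ?case by (simp only: cut_add.simps Cons) (simp only: ac_simps)
qed simp

lemma cut_add_zero [simp]: "cut_add w (\<lambda>x y. 0) = 0"
  by (induction w) simp_all

lemma additive_cut_add:
  assumes "additive f"
  shows "f (cut_add w F) = cut_add w (\<lambda>x y. f (F x y))"
  by (induction w F rule: cut_add.induct) (simp_all add: additive.add [OF assms])

lemma cut_add_eq_sum: "cut_add w F = (\<Sum>k\<le>length w. F (take k w) (drop k w))"
  by (induction w F rule: cut_add.induct) (simp_all add: sum.atMost_Suc_shift del: sum.atMost_Suc)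

text \<open>Both sides enumerate the cuts of \<open>w\<close> into three consecutive words, once by
  splitting the left part of a first cut and once by splitting the right part.\<close>

lemma cut_add_coassoc:
  "cut_add w (\<lambda>x y. cut_add x (\<lambda>x1 x2. F x1 x2 y)) = cut_add w (\<lambda>x y. cut_add y (F x))"
proof (induction w arbitrary: F)
  case (Cons a w)
  then show ?case by (simp add: cut_add_distrib algebra_simps)
qed simp

lemma cut_add_left_Nil:
  assumes "\<And>x y. x \<noteq> [] \<Longrightarrow> F x y = 0"
  shows "cut_add w F = F [] w"
proof (cases w)
  case (Cons a w')
  have "(\<lambda>x. F (a # x)) = (\<lambda>x y. 0)" using assms by (simp add: fun_eq_iff)
  with Cons show ?thesis by simp
qed simp

lemma cut_add_right_Nil:
  assumes "\<And>x y. y \<noteq> [] \<Longrightarrow> F x y = 0"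
  shows "cut_add w F = F w []"
  using assms by (induction w F rule: cut_add.induct) simp_all

text \<open>The combinatorial core of multiplicativity. If the left part of the cut shuffle is
  empty, the term is a full shuffle with \<open>G []\<close>; otherwise its first letter comes from
  \<open>u\<close> or from \<open>v\<close>, and removing it leaves an instance of smaller total
  length. Expanding the cuts of both words on the right yields the same three families.\<close>

lemma shuffle_add_cut_add:
  "shuffle_add u v (\<lambda>w. cut_add w G) =
   cut_add u (\<lambda>u1 u2. cut_add v (\<lambda>v1 v2. shuffle_add u1 v1 (\<lambda>x. shuffle_add u2 v2 (G x))))"
proof (induction "length u + length v" arbitrary: u v G rule: less_induct)
  case less
  show ?case
  proof (cases "u = [] \<or> v = []")
    case True then show ?thesis by auto
  next
    case False
    then obtain a u' b v' where uv: "u = a # u'" "v = b # v'" by (metis neq_Nil_conv)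
    have "shuffle_add u v (\<lambda>w. cut_add w G) = shuffle_add u v (G []) +
        shuffle_add u' v (\<lambda>w. cut_add w (\<lambda>x. G (a # x))) +
        shuffle_add u v' (\<lambda>w. cut_add w (\<lambda>x. G (b # x)))"
      by (simp add: uv shuffle_add_distrib algebra_simps)
    also have "\<dots> = shuffle_add u v (G []) +
        cut_add u' (\<lambda>u1 u2. cut_add v (\<lambda>v1 v2. shuffle_add u1 v1 (\<lambda>x. shuffle_add u2 v2 (G (a # x))))) +
        cut_add u (\<lambda>u1 u2. cut_add v' (\<lambda>v1 v2. shuffle_add u1 v1 (\<lambda>x. shuffle_add u2 v2 (G (b # x)))))"
      by (intro arg_cong2 [of _ _ _ _ "(+)"] less refl) (simp_all add: uv)
    also have "\<dots> = cut_add u (\<lambda>u1 u2. cut_add v (\<lambda>v1 v2. shuffle_add u1 v1 (\<lambda>x. shuffle_add u2 v2 (G x))))"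
      by (simp add: uv cut_add_distrib algebra_simps)
    finally show ?thesis .
  qed
qed


section \<open>Shuffles by positions\<close>

text \<open>Position 0 goes to the first word: later positions have their rank among the chosen ones
  raised by one, matching \<open>a # u\<close>, while ranks among the unchosen ones stay the
  same.\<close>

lemma shuffle_at_Cons_mem:
  "shuffle_at (insert 0 (Suc ` I)) (a # u) v = a # shuffle_at I u v"
proof (rule nth_equalityI)
  fix i assume "i < length (shuffle_at (insert 0 (Suc ` I)) (a # u) v)"
  then have i: "i < Suc (length u + length v)" by (simp add: shuffle_at_def)
  show "shuffle_at (insert 0 (Suc ` I)) (a # u) v ! i = (a # shuffle_at I u v) ! i"
  proof (cases i)
    case 0
    then show ?thesis by (simp add: shuffle_at_def nth_map_upt del: upt_Suc)
  next
    case (Suc k)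
    have "{j \<in> insert 0 (Suc ` I). j < Suc k} = insert 0 (Suc ` {j \<in> I. j < k})" by auto
    then have "card {j \<in> insert 0 (Suc ` I). j < Suc k} = Suc (card {j \<in> I. j < k})"
      by (simp add: card_image)
    moreover have "j \<notin> insert 0 (Suc ` I) \<and> j < Suc k \<longleftrightarrow> j \<in> Suc ` {j. j \<notin> I \<and> j < k}" for j
      by (cases j) auto
    then have "{j. j \<notin> insert 0 (Suc ` I) \<and> j < Suc k} = Suc ` {j. j \<notin> I \<and> j < k}" by blast
    then have "card {j. j \<notin> insert 0 (Suc ` I) \<and> j < Suc k} = card {j. j \<notin> I \<and> j < k}"
      by (simp add: card_image)
    ultimately show ?thesis
      using i Suc by (simp add: shuffle_at_def nth_map_upt inj_image_mem_iff del: upt_Suc)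
  qed
qed (simp add: shuffle_at_def)

text \<open>Position 0 goes to the second word, so now it is the ranks among the unchosen positions
  that rise by one.\<close>

lemma shuffle_at_Cons_not_mem:
  "shuffle_at (Suc ` I) u (b # v) = b # shuffle_at I u v"
proof (rule nth_equalityI)
  fix i assume "i < length (shuffle_at (Suc ` I) u (b # v))"
  then have i: "i < Suc (length u + length v)" by (simp add: shuffle_at_def)
  show "shuffle_at (Suc ` I) u (b # v) ! i = (b # shuffle_at I u v) ! i"
  proof (cases i)
    case 0
    then show ?thesis by (simp add: shuffle_at_def nth_map_upt image_iff del: upt_Suc)
  next
    case (Suc k)
    have "{j \<in> Suc ` I. j < Suc k} = Suc ` {j \<in> I. j < k}" by auto
    then have "card {j \<in> Suc ` I. j < Suc k} = card {j \<in> I. j < k}"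
      by (simp add: card_image)
    moreover have "j \<notin> Suc ` I \<and> j < Suc k \<longleftrightarrow> j \<in> insert 0 (Suc ` {j. j \<notin> I \<and> j < k})" for j
      by (cases j) auto
    then have "{j. j \<notin> Suc ` I \<and> j < Suc k} = insert 0 (Suc ` {j. j \<notin> I \<and> j < k})" by blast
    then have "card {j. j \<notin> Suc ` I \<and> j < Suc k} = Suc (card {j. j \<notin> I \<and> j < k})"
      by (simp add: card_image)
    ultimately show ?thesis
      using i Suc by (simp add: shuffle_at_def nth_map_upt inj_image_mem_iff del: upt_Suc)
  qed
qed (simp add: shuffle_at_def)

text \<open>The union separates position sets by whether they contain 0, that is, by the word that
  supplies the first letter. Its two parts correspond to the two summands in the recursion of
  \<open>shuffle_add\<close>.\<close>

lemma shuffle_positions_Cons: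
  "shuffle_positions (a # u) (b # v) =
     (\<lambda>I. insert 0 (Suc ` I)) ` shuffle_positions u (b # v) \<union>
     image Suc ` shuffle_positions (a # u) v"
proof (intro equalityI subsetI)
  fix I assume I: "I \<in> shuffle_positions (a # u) (b # v)"
  then have fin: "finite I" by (auto simp: shuffle_positions_def intro: finite_subset)
  define K where "K = {i. Suc i \<in> I}"
  show "I \<in> (\<lambda>I. insert 0 (Suc ` I)) ` shuffle_positions u (b # v) \<union>
     image Suc ` shuffle_positions (a # u) v"
  proof (cases "0 \<in> I")
    case True
    then have "i \<in> I \<longleftrightarrow> i \<in> insert 0 (Suc ` K)" for i
      by (cases i) (auto simp: K_def)
    then have IK: "I = insert 0 (Suc ` K)" by blast
    with fin have "finite K" by (metis finite_imageD finite_insert inj_Suc)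
    with IK have "card I = Suc (card K)" by (simp add: card_image)
    with I have "K \<in> shuffle_positions u (b # v)" by (auto simp: shuffle_positions_def K_def)
    with IK show ?thesis by blast
  next
    case False
    then have "i \<in> I \<longleftrightarrow> i \<in> Suc ` K" for i
      by (cases i) (auto simp: K_def)
    then have IK: "I = Suc ` K" by blast
    then have "card I = card K" by (simp add: card_image)
    with I have "K \<in> shuffle_positions (a # u) v" by (auto simp: shuffle_positions_def K_def)
    with IK show ?thesis by blast
  qed
next
  fix I assume "I \<in> (\<lambda>I. insert 0 (Suc ` I)) ` shuffle_positions u (b # v) \<union>
     image Suc ` shuffle_positions (a # u) v"
  then consider K where "I = insert 0 (Suc ` K)" "K \<in> shuffle_positions u (b # v)"
    | K where "I = Suc ` K" "K \<in> shuffle_positions (a # u) v" by blast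
  then show "I \<in> shuffle_positions (a # u) (b # v)"
  proof cases
    case 1
    then have "finite K" by (auto simp: shuffle_positions_def intro: finite_subset)
    then have "card I = Suc (card K)" using 1 by (simp add: card_image)
    then show ?thesis using 1 by (auto simp: shuffle_positions_def)
  next
    case 2
    then have "card I = card K" by (simp add: card_image)
    then show ?thesis using 2 by (auto simp: shuffle_positions_def)
  qed
qed

lemma shuffle_positions_Nil_left: "shuffle_positions [] v = {{}}"
  by (auto simp: shuffle_positions_def card_eq_0_iff intro: finite_subset)

lemma shuffle_positions_Nil_right: "shuffle_positions u [] = {{..<length u}}"
  by (auto simp: shuffle_positions_def intro: card_subset_eq [of "{..<length u}", THEN equalityD2, THEN subsetD])

lemma shuffle_at_Nil_left: "shuffle_at {} [] v = v"
  by (rule nth_equalityI) (simp_all add: shuffle_at_def)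

lemma shuffle_at_Nil_right: "shuffle_at {..<length u} u [] = u"
proof (rule nth_equalityI)
  fix i assume "i < length (shuffle_at {..<length u} u [])"
  then have i: "i < length u" by (simp add: shuffle_at_def)
  then have "{j. j < length u \<and> j < i} = {..<i}" by auto
  with i show "shuffle_at {..<length u} u [] ! i = u ! i" by (simp add: shuffle_at_def)
qed (simp add: shuffle_at_def)

text \<open>The bridge from the defining sum over position sets to the recursion. Distinct position
  sets may give equal words; each set contributes once, which is the required multiplicity.\<close>

lemma sum_shuffle_positions:
  "(\<Sum>I\<in>shuffle_positions u v. F (shuffle_at I u v)) = shuffle_add u v F"
proof (induction u v F rule: shuffle_add.induct)
  case (1 v F)
  then show ?case by (simp add: shuffle_positions_Nil_left shuffle_at_Nil_left)
next
  case (2 a u F)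
  show ?case
    unfolding shuffle_positions_Nil_right using shuffle_at_Nil_right [of "a # u"] by simp
next
  case (3 a u b v F)
  let ?f = "\<lambda>I. insert 0 (Suc ` I)"
  have "inj ?f" by (rule injI) (auto simp: set_eq_iff image_iff)
  moreover have "inj (image Suc)" by (rule injI) (simp add: inj_image_eq_iff)
  ultimately have inj: "inj_on ?f A" "inj_on (image Suc) B" for A B by (auto intro: inj_on_subset)
  have "(\<Sum>I\<in>shuffle_positions (a # u) (b # v). F (shuffle_at I (a # u) (b # v))) =
      (\<Sum>I\<in>?f ` shuffle_positions u (b # v). F (shuffle_at I (a # u) (b # v))) +
      (\<Sum>I\<in>image Suc ` shuffle_positions (a # u) v. F (shuffle_at I (a # u) (b # v)))"
    unfolding shuffle_positions_Cons
    by (rule sum.union_disjoint) (auto intro!: finite_imageI finite_shuffle_positions)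
  also have "\<dots> = (\<Sum>I\<in>shuffle_positions u (b # v). F (a # shuffle_at I u (b # v))) +
      (\<Sum>I\<in>shuffle_positions (a # u) v. F (b # shuffle_at I (a # u) v))"
    by (simp add: sum.reindex inj shuffle_at_Cons_mem shuffle_at_Cons_not_mem)
  finally show ?case using 3 by simp
qed


section \<open>Structure maps on basis elements\<close>

lemma additive_frag_ext:
  fixes f g :: "('b \<Rightarrow>\<^sub>0 int) \<Rightarrow> 'a::ab_group_add"
  assumes "additive f" "additive g" "\<And>p. f (frag_of p) = g (frag_of p)"
  shows "f = g"
proof
  fix x
  interpret f: additive f by fact
  interpret g: additive g by fact
  show "f x = g x"
    by (induction x rule: frag_induction [OF subset_UNIV])
      (simp_all add: f.zero g.zero f.diff g.diff assms(3))
qed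

lemma additive_frag_tensor_ext:
  fixes f g :: "('b \<Rightarrow>\<^sub>0 int, 'c \<Rightarrow>\<^sub>0 int) tensor \<Rightarrow> 'a::ab_group_add"
  assumes "additive f" "additive g"
    and "\<And>p q. f (frag_of p \<otimes>\<^sub>Z frag_of q) = g (frag_of p \<otimes>\<^sub>Z frag_of q)"
  shows "f = g"
proof (rule additive_tensor_ext [OF assms(1,2)])
  fix x y
  have "f \<circ> (\<lambda>y. frag_of p \<otimes>\<^sub>Z y) = g \<circ> (\<lambda>y. frag_of p \<otimes>\<^sub>Z y)" for p
    by (rule additive_frag_ext)
      ((intro additive_comp assms(1,2) additive_tens_right; fail) | simp add: assms(3))+
  then have 1: "f (frag_of p \<otimes>\<^sub>Z y) = g (frag_of p \<otimes>\<^sub>Z y)" for p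
    by (simp add: fun_eq_iff)
  have "f \<circ> (\<lambda>x. x \<otimes>\<^sub>Z y) = g \<circ> (\<lambda>x. x \<otimes>\<^sub>Z y)"
    by (rule additive_frag_ext)
      ((intro additive_comp assms(1,2) additive_tens_left; fail) | simp add: 1)+
  then show "f (x \<otimes>\<^sub>Z y) = g (x \<otimes>\<^sub>Z y)" by (simp add: fun_eq_iff)
qed

lemma additive_frag_tensor3_ext:
  fixes f g :: "(('b \<Rightarrow>\<^sub>0 int, 'c \<Rightarrow>\<^sub>0 int) tensor, 'd \<Rightarrow>\<^sub>0 int) tensor \<Rightarrow> 'a::ab_group_add"
  assumes "additive f" "additive g"
    and "\<And>p q r. f ((frag_of p \<otimes>\<^sub>Z frag_of q) \<otimes>\<^sub>Z frag_of r) = g ((frag_of p \<otimes>\<^sub>Z frag_of q) \<otimes>\<^sub>Z frag_of r)"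
  shows "f = g"
proof (rule additive_tensor_ext [OF assms(1,2)])
  fix t z
  have "f \<circ> (\<lambda>z. (frag_of p \<otimes>\<^sub>Z frag_of q) \<otimes>\<^sub>Z z) = g \<circ> (\<lambda>z. (frag_of p \<otimes>\<^sub>Z frag_of q) \<otimes>\<^sub>Z z)" for p q
    by (rule additive_frag_ext)
      ((intro additive_comp assms(1,2) additive_tens_right; fail) | simp add: assms(3))+
  then have 1: "f ((frag_of p \<otimes>\<^sub>Z frag_of q) \<otimes>\<^sub>Z z) = g ((frag_of p \<otimes>\<^sub>Z frag_of q) \<otimes>\<^sub>Z z)" for p q
    by (simp add: fun_eq_iff)
  have "f \<circ> (\<lambda>t. t \<otimes>\<^sub>Z z) = g \<circ> (\<lambda>t. t \<otimes>\<^sub>Z z)"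
    by (rule additive_frag_tensor_ext)
      ((intro additive_comp assms(1,2) additive_tens_left; fail) | simp add: 1)+
  then show "f (t \<otimes>\<^sub>Z z) = g (t \<otimes>\<^sub>Z z)" by (simp add: fun_eq_iff)
qed

text \<open>The explicit product formula needs representatives with disjoint supports. Shifting all
  letters beyond the finite set \<open>X\<close> is an injective renaming.\<close>

lemma Subst_cases_disjoint:
  assumes "finite X"
  obtains \<rho> \<sigma> where "p = Subst \<rho> \<sigma>" "set \<rho> = set \<sigma>" "set \<rho> \<inter> X = {}"
proof -
  obtain \<rho> \<sigma> where p: "p = Subst \<rho> \<sigma>" "set \<rho> = set \<sigma>" by (rule Subst_cases)
  obtain N where N: "\<forall>x\<in>X. x < N" using assms finite_nat_set_iff_bounded by blast
  let ?f = "\<lambda>x. x + N"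
  have "renaming (\<rho>, \<sigma>) (map ?f \<rho>, map ?f \<sigma>)"
    by (rule renamingI [of _ _ ?f]) (use p in \<open>auto simp: inj_on_def\<close>)
  then have "p = Subst (map ?f \<rho>) (map ?f \<sigma>)"
    using Subst_eq_iff [of \<rho> \<sigma> "map ?f \<rho>" "map ?f \<sigma>"] p by simp
  moreover have "set (map ?f \<rho>) \<inter> X = {}" using N by fastforce
  ultimately show ?thesis using that p(2) by simp
qed

lemma subst_mult_shuffle_add:
  assumes "set \<rho> = set \<sigma>" "set \<rho>' = set \<sigma>'" "set \<rho> \<inter> set \<rho>' = {}"
  shows "subst_mult (Subst \<rho> \<sigma>) (Subst \<rho>' \<sigma>') =
    shuffle_add \<sigma> \<sigma>' (\<lambda>w. frag_of (Subst (\<rho> @ \<rho>') w))"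
  unfolding subst_mult_Subst [OF assms] by (rule sum_shuffle_positions)

text \<open>Bad cuts reappear as zero summands, so that identities for sums over all cuts become
  applicable.\<close>

lemma subst_comult_cut_add:
  assumes "set \<rho> = set \<sigma>"
  shows "subst_comult (Subst \<rho> \<sigma>) = cut_add \<sigma> (\<lambda>x y. if set x \<inter> set y = {}
    then frag_of (subst_part \<rho> x) \<otimes>\<^sub>Z frag_of (subst_part \<rho> y) else 0)"
proof -
  have "good_cuts \<sigma> = {k \<in> {..length \<sigma>}. set (take k \<sigma>) \<inter> set (drop k \<sigma>) = {}}"
    by (auto simp: good_cuts_def)
  then show ?thesis
    unfolding subst_comult_Subst [OF assms] cut_add_eq_sum
    by (simp only: sum.inter_filter [OF finite_atMost])
qed

lemma subst_part_self: "set \<rho> = set \<sigma> \<Longrightarrow> subst_part \<rho> \<sigma> = Subst \<rho> \<sigma>"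
  by (simp add: subst_part_def filter_id_conv [THEN iffD2])

lemma subst_part_Nil: "subst_part \<rho> [] = empty_subst"
  by (simp add: subst_part_def)

text \<open>Restricting the first row twice is the same as restricting it once to the smaller
  support. In an iterated coproduct every piece can thus be written with the original
  \<open>\<rho>\<close>.\<close>

lemma subst_part_filter:
  "set x \<subseteq> set y \<Longrightarrow> subst_part (filter (\<lambda>a. a \<in> set y) \<rho>) x = subst_part \<rho> x"
  unfolding subst_part_def by (simp add: conj_commute) (metis (mono_tags, lifting) filter_cong subsetD)

lemma set_filter_part: "set x \<subseteq> set \<rho> \<Longrightarrow> set (filter (\<lambda>a. a \<in> set x) \<rho>) = set x"
  by auto

lemma Subst_eq_empty_iff: "set \<rho> = set \<sigma> \<Longrightarrow> Subst \<rho> \<sigma> = empty_subst \<longleftrightarrow> \<sigma> = []"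
  by (subst Subst_eq_iff) (auto simp: renaming_def bij_betw_def)

lemma subst_part_eq_empty_iff: "set x \<subseteq> set \<rho> \<Longrightarrow> subst_part \<rho> x = empty_subst \<longleftrightarrow> x = []"
  unfolding subst_part_def by (rule Subst_eq_empty_iff) auto

lemma subst_deg_Subst: "set \<rho> = set \<sigma> \<Longrightarrow> subst_deg (Subst \<rho> \<sigma>) = card (set \<rho>)"
  unfolding Subst_def by (simp add: subst_deg.abs_eq renaming_refl)

lemma subst_deg_part: "set x \<subseteq> set \<rho> \<Longrightarrow> subst_deg (subst_part \<rho> x) = card (set x)"
  unfolding subst_part_def by (subst subst_deg_Subst) (auto intro!: arg_cong [of _ _ card])

text \<open>The source of connectedness: degree 0 has a single basis element.\<close>

lemma subst_deg_eq_0_iff: "subst_deg p = 0 \<longleftrightarrow> p = empty_subst"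
proof -
  obtain \<rho> \<sigma> where p: "p = Subst \<rho> \<sigma>" "set \<rho> = set \<sigma>" by (rule Subst_cases)
  then show ?thesis by (simp add: subst_deg_Subst Subst_eq_empty_iff)
qed

lemma additive_dWHA_mult: "additive dWHA_mult"
  unfolding dWHA_mult_def
  by (intro additive_tensor_lift biadditiveI)
    (simp_all add: additive_def free_lift_add free_lift_fun_add)

lemma additive_dWHA_comult: "additive dWHA_comult"
  unfolding dWHA_comult_def by (rule additive_free_lift)

lemma additive_dWHA_counit: "additive dWHA_counit"
  unfolding dWHA_counit_def by (rule additive_free_lift)

lemma additive_dWHA_unit: "additive dWHA_unit"
  by (simp add: additive_def dWHA_unit_def frag_cmul_distrib)

lemma dWHA_comult_of: "dWHA_comult (frag_of p) = subst_comult p"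
  by (simp add: dWHA_comult_def)

lemma dWHA_counit_of: "dWHA_counit (frag_of p) = (if p = empty_subst then 1 else 0)"
  by (simp add: dWHA_counit_def)

lemma zscale_frag: "zscale k x = frag_cmul k x"
proof -
  have *: "(\<Sum>i<n. x) = frag_cmul (int n) x" for n
    by (induction n) (simp_all add: frag_cmul_distrib add.commute)
  have "frag_cmul (int (nat k)) x - frag_cmul (int (nat (- k))) x = frag_cmul k x"
    by (cases "k \<ge> 0") simp_all
  then show ?thesis by (simp only: zscale_def *)
qed

lemma dWHA_unit_zscale: "dWHA_unit k = zscale k (frag_of empty_subst)"
  by (simp add: dWHA_unit_def zscale_frag)

section \<open>Associativity and unit laws of the multiplication\<close>

lemma dWHA_mult_tens_shuffle_add_left:
  "dWHA_mult (shuffle_add u v F \<otimes>\<^sub>Z y) = shuffle_add u v (\<lambda>w. dWHA_mult (F w \<otimes>\<^sub>Z y))"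
  using additive_shuffle_add [OF additive_comp [OF additive_dWHA_mult additive_tens_left]] by simp

lemma dWHA_mult_tens_shuffle_add_right:
  "dWHA_mult (y \<otimes>\<^sub>Z shuffle_add u v F) = shuffle_add u v (\<lambda>w. dWHA_mult (y \<otimes>\<^sub>Z F w))"
  using additive_shuffle_add [OF additive_comp [OF additive_dWHA_mult additive_tens_right]] by simp

lemma dWHA_mult_assoc:
  "dWHA_mult \<circ> tensor_map dWHA_mult id = dWHA_mult \<circ> tensor_map id dWHA_mult \<circ> tensor_assoc"
proof (rule additive_frag_tensor3_ext)
  show "additive (dWHA_mult \<circ> tensor_map dWHA_mult id)"
    "additive (dWHA_mult \<circ> tensor_map id dWHA_mult \<circ> tensor_assoc)"
    by (intro additive_comp additive_tensor_map additive_dWHA_mult additive_id additive_tensor_assoc)+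
  fix p q r
  obtain \<rho> \<sigma> where p: "p = Subst \<rho> \<sigma>" "set \<rho> = set \<sigma>" by (rule Subst_cases)
  obtain \<rho>' \<sigma>' where q: "q = Subst \<rho>' \<sigma>'" "set \<rho>' = set \<sigma>'" "set \<rho>' \<inter> set \<rho> = {}"
    using Subst_cases_disjoint [of "set \<rho>"] by blast
  obtain \<rho>'' \<sigma>'' where r: "r = Subst \<rho>'' \<sigma>''" "set \<rho>'' = set \<sigma>''" "set \<rho>'' \<inter> (set \<rho> \<union> set \<rho>') = {}"
    using Subst_cases_disjoint [of "set \<rho> \<union> set \<rho>'"] by blast
  \<comment> \<open>With pairwise disjoint supports, both bracketings have the same first row, by
    associativity of concatenation. Only the second rows remain to be compared, as an iterated
    shuffle with summand \<open>?F\<close>.\<close>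
  let ?F = "\<lambda>w. frag_of (Subst (\<rho> @ \<rho>' @ \<rho>'') w)"
  have "dWHA_mult (subst_mult p q \<otimes>\<^sub>Z frag_of r) = shuffle_add \<sigma> \<sigma>' (\<lambda>w. shuffle_add w \<sigma>'' ?F)"
  proof -
    have "subst_mult p q = shuffle_add \<sigma> \<sigma>' (\<lambda>w. frag_of (Subst (\<rho> @ \<rho>') w))"
      unfolding p q by (rule subst_mult_shuffle_add) (use p q in auto)
    moreover have "subst_mult (Subst (\<rho> @ \<rho>') w) r = shuffle_add w \<sigma>'' ?F"
      if "set w = set \<sigma> \<union> set \<sigma>'" for w
      unfolding r by (subst subst_mult_shuffle_add) (use that p q r in auto)
    ultimately show ?thesis
      by (simp add: dWHA_mult_tens_shuffle_add_left dWHA_mult_basis cong: shuffle_add_cong)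
  qed
  moreover have "dWHA_mult (frag_of p \<otimes>\<^sub>Z subst_mult q r) = shuffle_add \<sigma>' \<sigma>'' (\<lambda>w. shuffle_add \<sigma> w ?F)"
  proof -
    have "subst_mult q r = shuffle_add \<sigma>' \<sigma>'' (\<lambda>w. frag_of (Subst (\<rho>' @ \<rho>'') w))"
      unfolding q r by (rule subst_mult_shuffle_add) (use q r in auto)
    moreover have "subst_mult p (Subst (\<rho>' @ \<rho>'') w) = shuffle_add \<sigma> w ?F"
      if "set w = set \<sigma>' \<union> set \<sigma>''" for w
      unfolding p by (subst subst_mult_shuffle_add) (use that p q r in auto)
    ultimately show ?thesis
      by (simp add: dWHA_mult_tens_shuffle_add_right dWHA_mult_basis cong: shuffle_add_cong)
  qed
  ultimately have "dWHA_mult (subst_mult p q \<otimes>\<^sub>Z frag_of r) = dWHA_mult (frag_of p \<otimes>\<^sub>Z subst_mult q r)"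
    by (simp add: shuffle_add_assoc)
  then show "(dWHA_mult \<circ> tensor_map dWHA_mult id) ((frag_of p \<otimes>\<^sub>Z frag_of q) \<otimes>\<^sub>Z frag_of r) =
      (dWHA_mult \<circ> tensor_map id dWHA_mult \<circ> tensor_assoc) ((frag_of p \<otimes>\<^sub>Z frag_of q) \<otimes>\<^sub>Z frag_of r)"
    by (simp only: comp_apply tensor_assoc_tens tensor_map_tens [OF additive_dWHA_mult additive_id]
        tensor_map_tens [OF additive_id additive_dWHA_mult] id_apply dWHA_mult_basis)
qed

lemma subst_mult_empty [simp]: "subst_mult empty_subst p = frag_of p" "subst_mult p empty_subst = frag_of p"
proof -
  obtain \<rho> \<sigma> where p: "p = Subst \<rho> \<sigma>" "set \<rho> = set \<sigma>" by (rule Subst_cases)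
  show "subst_mult empty_subst p = frag_of p" "subst_mult p empty_subst = frag_of p"
    unfolding p(1) by (subst subst_mult_shuffle_add; simp add: p)+
qed

lemma dWHA_mult_unit:
  "dWHA_mult (frag_of empty_subst \<otimes>\<^sub>Z x) = x" "dWHA_mult (x \<otimes>\<^sub>Z frag_of empty_subst) = x"
proof -
  have "dWHA_mult \<circ> (\<lambda>x. frag_of empty_subst \<otimes>\<^sub>Z x) = id"
    by (rule additive_frag_ext)
      ((intro additive_comp additive_dWHA_mult additive_tens_right additive_id; fail) | simp add: dWHA_mult_basis)+
  then show "dWHA_mult (frag_of empty_subst \<otimes>\<^sub>Z x) = x" by (simp add: fun_eq_iff)
  have "dWHA_mult \<circ> (\<lambda>x. x \<otimes>\<^sub>Z frag_of empty_subst) = id"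
    by (rule additive_frag_ext)
      ((intro additive_comp additive_dWHA_mult additive_tens_left additive_id; fail) | simp add: dWHA_mult_basis)+
  then show "dWHA_mult (x \<otimes>\<^sub>Z frag_of empty_subst) = x" by (simp add: fun_eq_iff)
qed

lemma tens_zscale: "zscale k x \<otimes>\<^sub>Z y = zscale k (x \<otimes>\<^sub>Z y)" "x \<otimes>\<^sub>Z zscale k y = zscale k (x \<otimes>\<^sub>Z y)"
  using additive_zscale [OF additive_tens_left] additive_zscale [OF additive_tens_right] by auto

lemma dWHA_algebra: "algebra dWHA_mult dWHA_unit"
proof -
  have "dWHA_mult \<circ> tensor_map dWHA_unit id = tensor_lunit"
  proof (rule additive_tensor_ext)
    show "additive (dWHA_mult \<circ> tensor_map dWHA_unit id)"
      by (intro additive_comp additive_tensor_map additive_dWHA_mult additive_id additive_dWHA_unit)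
    show "(dWHA_mult \<circ> tensor_map dWHA_unit id) (a \<otimes>\<^sub>Z b) = tensor_lunit (a \<otimes>\<^sub>Z b)" for a b
      by (simp add: tensor_map_tens [OF additive_dWHA_unit additive_id, unfolded id_def] id_def tensor_lunit_tens dWHA_unit_zscale tens_zscale
          additive_zscale [OF additive_dWHA_mult] dWHA_mult_unit)
  qed (rule additive_tensor_lunit)
  moreover have "dWHA_mult \<circ> tensor_map id dWHA_unit = tensor_runit"
  proof (rule additive_tensor_ext)
    show "additive (dWHA_mult \<circ> tensor_map id dWHA_unit)"
      by (intro additive_comp additive_tensor_map additive_dWHA_mult additive_id additive_dWHA_unit)
    show "(dWHA_mult \<circ> tensor_map id dWHA_unit) (a \<otimes>\<^sub>Z b) = tensor_runit (a \<otimes>\<^sub>Z b)" for a b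
      by (simp add: tensor_map_tens [OF additive_id additive_dWHA_unit, unfolded id_def] id_def tensor_runit_tens dWHA_unit_zscale tens_zscale
          additive_zscale [OF additive_dWHA_mult] dWHA_mult_unit)
  qed (rule additive_tensor_runit)
  ultimately show ?thesis
    unfolding algebra_def using additive_dWHA_mult additive_dWHA_unit dWHA_mult_assoc by blast
qed


section \<open>Coassociativity and counit laws\<close>

lemma dWHA_comult_coassoc:
  "tensor_assoc \<circ> tensor_map dWHA_comult id \<circ> dWHA_comult = tensor_map id dWHA_comult \<circ> dWHA_comult"
proof (rule additive_frag_ext)
  have add1: "additive (tensor_assoc \<circ> tensor_map dWHA_comult id)"
    and add2: "additive (tensor_map id dWHA_comult)"
    by (intro additive_comp additive_tensor_map additive_dWHA_comult additive_id additive_tensor_assoc)+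
  show "additive (tensor_assoc \<circ> tensor_map dWHA_comult id \<circ> dWHA_comult)"
    by (rule additive_comp [OF add1 additive_dWHA_comult])
  show "additive (tensor_map id dWHA_comult \<circ> dWHA_comult)"
    by (rule additive_comp [OF add2 additive_dWHA_comult])
  fix p
  obtain \<rho> \<sigma> where p: "p = Subst \<rho> \<sigma>" "set \<rho> = set \<sigma>" by (rule Subst_cases)
  let ?p = "\<lambda>x. frag_of (subst_part \<rho> x)"
  have part: "subst_comult (subst_part \<rho> x) =
      cut_add x (\<lambda>x1 x2. if set x1 \<inter> set x2 = {} then ?p x1 \<otimes>\<^sub>Z ?p x2 else 0)"
    if "set x \<subseteq> set \<rho>" for x
  proof -
    have "subst_comult (subst_part \<rho> x) = cut_add x (\<lambda>x1 x2. if set x1 \<inter> set x2 = {}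
        then frag_of (subst_part (filter (\<lambda>a. a \<in> set x) \<rho>) x1) \<otimes>\<^sub>Z
          frag_of (subst_part (filter (\<lambda>a. a \<in> set x) \<rho>) x2) else 0)"
      unfolding subst_part_def [of \<rho> x]
      by (rule subst_comult_cut_add) (rule set_filter_part [OF that])
    also have "\<dots> = cut_add x (\<lambda>x1 x2. if set x1 \<inter> set x2 = {} then ?p x1 \<otimes>\<^sub>Z ?p x2 else 0)"
    proof (rule cut_add_cong)
      fix x1 x2 assume "x1 @ x2 = x"
      then have "set x1 \<subseteq> set x" "set x2 \<subseteq> set x" by auto
      then show "(if set x1 \<inter> set x2 = {} then frag_of (subst_part (filter (\<lambda>a. a \<in> set x) \<rho>) x1) \<otimes>\<^sub>Z
          frag_of (subst_part (filter (\<lambda>a. a \<in> set x) \<rho>) x2) else 0) =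
          (if set x1 \<inter> set x2 = {} then ?p x1 \<otimes>\<^sub>Z ?p x2 else 0)"
        by (simp only: subst_part_filter)
    qed
    finally show ?thesis .
  qed
  \<comment> \<open>A good cut followed by a good cut of one of its parts amounts to three pairwise
    disjoint words. This condition does not depend on which part was cut, so one summand
    \<open>F\<close> serves both bracketings.\<close>
  define F where "F = (\<lambda>x1 x2 x3. if set x1 \<inter> set x2 = {} \<and> set x1 \<inter> set x3 = {} \<and> set x2 \<inter> set x3 = {}
    then ?p x1 \<otimes>\<^sub>Z (?p x2 \<otimes>\<^sub>Z ?p x3) else 0)"
  have "(tensor_assoc \<circ> tensor_map dWHA_comult id) (subst_comult p) =
      cut_add \<sigma> (\<lambda>x y. cut_add x (\<lambda>x1 x2. F x1 x2 y))"
    unfolding p(1) subst_comult_cut_add [OF p(2)] additive_cut_add [OF add1]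
  proof (rule cut_add_cong)
    fix x y assume xy: "x @ y = \<sigma>"
    have "(tensor_assoc \<circ> tensor_map dWHA_comult id) (?p x \<otimes>\<^sub>Z ?p y) = cut_add x (\<lambda>x1 x2. F x1 x2 y)"
      if d: "set x \<inter> set y = {}"
    proof -
      have x: "set x \<subseteq> set \<rho>" unfolding p(2) xy [symmetric] by simp
      have add: "additive (tensor_assoc \<circ> (\<lambda>s. s \<otimes>\<^sub>Z ?p y))"
        by (intro additive_comp additive_tensor_assoc additive_tens_left)
      have "(tensor_assoc \<circ> tensor_map dWHA_comult id) (?p x \<otimes>\<^sub>Z ?p y) =
          (tensor_assoc \<circ> (\<lambda>s. s \<otimes>\<^sub>Z ?p y)) (subst_comult (subst_part \<rho> x))"
        by (simp only: comp_apply tensor_map_tens [OF additive_dWHA_comult additive_id] id_apply dWHA_comult_of)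
      also have "\<dots> = cut_add x (\<lambda>x1 x2. F x1 x2 y)"
        unfolding part [OF x] additive_cut_add [OF add]
        by (rule cut_add_cong)
          (use d in \<open>auto simp: F_def tensor_assoc_tens additive.zero [OF additive_tensor_assoc]\<close>)
      finally show ?thesis .
    qed
    \<comment> \<open>If the outer cut is bad, a letter shared with \<open>y\<close> lies in
      \<open>x1\<close> or in \<open>x2\<close> for every inner cut, so \<open>F\<close> vanishes
      throughout.\<close>
    moreover have "cut_add x (\<lambda>x1 x2. F x1 x2 y) = 0" if d: "set x \<inter> set y \<noteq> {}"
    proof -
      have "cut_add x (\<lambda>x1 x2. F x1 x2 y) = cut_add x (\<lambda>x1 x2. 0)"
        by (rule cut_add_cong) (use d in \<open>auto simp: F_def\<close>)
      then show ?thesis by simp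
    qed
    ultimately show "(tensor_assoc \<circ> tensor_map dWHA_comult id)
        (if set x \<inter> set y = {} then ?p x \<otimes>\<^sub>Z ?p y else 0) = cut_add x (\<lambda>x1 x2. F x1 x2 y)"
      using additive.zero [OF add1] by (cases "set x \<inter> set y = {}") (simp_all only: if_True if_False simp_thms)
  qed
  moreover have "tensor_map id dWHA_comult (subst_comult p) = cut_add \<sigma> (\<lambda>x y. cut_add y (F x))"
    unfolding p(1) subst_comult_cut_add [OF p(2)] additive_cut_add [OF add2]
  proof (rule cut_add_cong)
    fix x y assume xy: "x @ y = \<sigma>"
    have "tensor_map id dWHA_comult (?p x \<otimes>\<^sub>Z ?p y) = cut_add y (F x)"
      if d: "set x \<inter> set y = {}"
    proof -
      have y: "set y \<subseteq> set \<rho>" unfolding p(2) xy [symmetric] by simp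
      have "tensor_map id dWHA_comult (?p x \<otimes>\<^sub>Z ?p y) = ?p x \<otimes>\<^sub>Z subst_comult (subst_part \<rho> y)"
        by (simp only: tensor_map_tens [OF additive_id additive_dWHA_comult] id_apply dWHA_comult_of)
      also have "\<dots> = cut_add y (F x)"
        unfolding part [OF y] additive_cut_add [OF additive_tens_right]
        by (rule cut_add_cong) (use d in \<open>auto simp: F_def\<close>)
      finally show ?thesis .
    qed
    moreover have "cut_add y (F x) = 0" if d: "set x \<inter> set y \<noteq> {}"
    proof -
      have "cut_add y (F x) = cut_add y (\<lambda>x1 x2. 0)"
        by (rule cut_add_cong) (use d in \<open>auto simp: F_def\<close>)
      then show ?thesis by simp
    qed
    ultimately show "tensor_map id dWHA_comult
        (if set x \<inter> set y = {} then ?p x \<otimes>\<^sub>Z ?p y else 0) = cut_add y (F x)"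
      using additive.zero [OF add2] by (cases "set x \<inter> set y = {}") (simp_all only: if_True if_False simp_thms)
  qed
  ultimately have "(tensor_assoc \<circ> tensor_map dWHA_comult id) (subst_comult p) =
      tensor_map id dWHA_comult (subst_comult p)"
    by (simp only: cut_add_coassoc)
  then show "(tensor_assoc \<circ> tensor_map dWHA_comult id \<circ> dWHA_comult) (frag_of p) =
      (tensor_map id dWHA_comult \<circ> dWHA_comult) (frag_of p)"
    by (simp only: comp_apply dWHA_comult_of)
qed

lemma dWHA_coalgebra: "coalgebra dWHA_comult dWHA_counit"
proof -
  have "tensor_lunit \<circ> tensor_map dWHA_counit id \<circ> dWHA_comult = id"
  proof (rule additive_frag_ext)
    have add: "additive (tensor_lunit \<circ> tensor_map dWHA_counit id)"
      by (intro additive_comp additive_tensor_map additive_dWHA_counit additive_id additive_tensor_lunit)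
    then show "additive (tensor_lunit \<circ> tensor_map dWHA_counit id \<circ> dWHA_comult)"
      by (rule additive_comp) (rule additive_dWHA_comult)
    fix p
    obtain \<rho> \<sigma> where p: "p = Subst \<rho> \<sigma>" "set \<rho> = set \<sigma>" by (rule Subst_cases)
    \<comment> \<open>The counit of the left part is nonzero only if that part is empty, and the cut
      with empty left part is always good. Hence exactly one trivial cut survives.\<close>
    have "(tensor_lunit \<circ> tensor_map dWHA_counit id) (subst_comult p) =
        cut_add \<sigma> (\<lambda>x y. if x = [] then frag_of (subst_part \<rho> y) else 0)"
      unfolding p(1) subst_comult_cut_add [OF p(2)] additive_cut_add [OF add]
    proof (rule cut_add_cong)
      fix x y assume xy: "x @ y = \<sigma>"
      have "set x \<subseteq> set \<rho>" unfolding p(2) xy [symmetric] by simp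
      note empty = subst_part_eq_empty_iff [OF this]
      have tens: "(tensor_lunit \<circ> tensor_map dWHA_counit id) (a \<otimes>\<^sub>Z b) = zscale (dWHA_counit a) b" for a and b :: dWHA
        by (simp only: comp_apply tensor_map_tens [OF additive_dWHA_counit additive_id] tensor_lunit_tens id_apply)
      show "(tensor_lunit \<circ> tensor_map dWHA_counit id)
          (if set x \<inter> set y = {} then frag_of (subst_part \<rho> x) \<otimes>\<^sub>Z frag_of (subst_part \<rho> y) else 0) =
          (if x = [] then frag_of (subst_part \<rho> y) else 0)"
      proof (cases "set x \<inter> set y = {}")
        case True
        show ?thesis by (simp only: if_P [OF True] tens dWHA_counit_of empty) simp
      next
        case False
        then have "x \<noteq> []" by auto
        then show ?thesis by (simp only: if_not_P [OF False] additive.zero [OF add] if_False simp_thms)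
      qed
    qed
    also have "\<dots> = frag_of p" by (subst cut_add_left_Nil) (auto simp: p subst_part_self)
    finally show "(tensor_lunit \<circ> tensor_map dWHA_counit id \<circ> dWHA_comult) (frag_of p) = id (frag_of p)"
      by (simp only: comp_apply dWHA_comult_of id_apply)
  qed (rule additive_id)
  moreover have "tensor_runit \<circ> tensor_map id dWHA_counit \<circ> dWHA_comult = id"
  proof (rule additive_frag_ext)
    have add: "additive (tensor_runit \<circ> tensor_map id dWHA_counit)"
      by (intro additive_comp additive_tensor_map additive_dWHA_counit additive_id additive_tensor_runit)
    then show "additive (tensor_runit \<circ> tensor_map id dWHA_counit \<circ> dWHA_comult)"
      by (rule additive_comp) (rule additive_dWHA_comult)
    fix p
    obtain \<rho> \<sigma> where p: "p = Subst \<rho> \<sigma>" "set \<rho> = set \<sigma>" by (rule Subst_cases)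
    have "(tensor_runit \<circ> tensor_map id dWHA_counit) (subst_comult p) =
        cut_add \<sigma> (\<lambda>x y. if y = [] then frag_of (subst_part \<rho> x) else 0)"
      unfolding p(1) subst_comult_cut_add [OF p(2)] additive_cut_add [OF add]
    proof (rule cut_add_cong)
      fix x y assume xy: "x @ y = \<sigma>"
      have "set y \<subseteq> set \<rho>" unfolding p(2) xy [symmetric] by simp
      note empty = subst_part_eq_empty_iff [OF this]
      have tens: "(tensor_runit \<circ> tensor_map id dWHA_counit) (a \<otimes>\<^sub>Z b) = zscale (dWHA_counit b) a" for a :: dWHA and b
        by (simp only: comp_apply tensor_map_tens [OF additive_id additive_dWHA_counit] tensor_runit_tens id_apply)
      show "(tensor_runit \<circ> tensor_map id dWHA_counit)
          (if set x \<inter> set y = {} then frag_of (subst_part \<rho> x) \<otimes>\<^sub>Z frag_of (subst_part \<rho> y) else 0) =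
          (if y = [] then frag_of (subst_part \<rho> x) else 0)"
      proof (cases "set x \<inter> set y = {}")
        case True
        show ?thesis by (simp only: if_P [OF True] tens dWHA_counit_of empty) simp
      next
        case False
        then have "y \<noteq> []" by auto
        then show ?thesis by (simp only: if_not_P [OF False] additive.zero [OF add] if_False simp_thms)
      qed
    qed
    also have "\<dots> = frag_of p" by (subst cut_add_right_Nil) (auto simp: p subst_part_self)
    finally show "(tensor_runit \<circ> tensor_map id dWHA_counit \<circ> dWHA_comult) (frag_of p) = id (frag_of p)"
      by (simp only: comp_apply dWHA_comult_of id_apply)
  qed (rule additive_id)
  ultimately show ?thesis
    unfolding coalgebra_def
    using additive_dWHA_comult additive_dWHA_counit dWHA_comult_coassoc by blast
qed

section \<open>Compatibility of comultiplication and counit with the multiplication\<close>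

lemma additive_int_mult: "additive int_mult"
  unfolding int_mult_def
  by (intro additive_tensor_lift) (simp add: biadditive_def additive_def algebra_simps)

lemma int_mult_tens: "int_mult (k \<otimes>\<^sub>Z l) = k * l"
  unfolding int_mult_def
  by (rule tensor_lift_tens) (simp add: biadditive_def additive_def algebra_simps)

lemma dWHA_comult_mult:
  "dWHA_comult \<circ> dWHA_mult = tensor_map dWHA_mult dWHA_mult \<circ> tensor_comult dWHA_comult"
proof (rule additive_frag_tensor_ext)
  \<comment> \<open>What remains of the right-hand side after both factors are comultiplied; being
    additive, it can be moved inside the two cut sums.\<close>
  let ?mm = "tensor_map dWHA_mult dWHA_mult \<circ> tensor_interchange"
  have mm: "additive ?mm"
    by (intro additive_comp additive_tensor_map additive_dWHA_mult additive_tensor_interchange)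
  show "additive (dWHA_comult \<circ> dWHA_mult)"
    "additive (tensor_map dWHA_mult dWHA_mult \<circ> tensor_comult dWHA_comult)"
    unfolding tensor_comult_def
    by (intro additive_comp additive_tensor_map additive_dWHA_mult additive_dWHA_comult
        additive_tensor_interchange)+
  fix p q
  obtain \<rho> \<sigma> where p: "p = Subst \<rho> \<sigma>" "set \<rho> = set \<sigma>" by (rule Subst_cases)
  obtain \<rho>' \<sigma>' where q: "q = Subst \<rho>' \<sigma>'" "set \<rho>' = set \<sigma>'" "set \<rho>' \<inter> set \<rho> = {}"
    using Subst_cases_disjoint [of "set \<rho>"] by blast
  let ?pq = "\<lambda>x. frag_of (subst_part (\<rho> @ \<rho>') x)"
  define G where "G = (\<lambda>x y. if set x \<inter> set y = {} then ?pq x \<otimes>\<^sub>Z ?pq y else 0)"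
  have "dWHA_comult (subst_mult p q) = shuffle_add \<sigma> \<sigma>' (\<lambda>w. cut_add w G)"
  proof -
    have "subst_mult p q = shuffle_add \<sigma> \<sigma>' (\<lambda>w. frag_of (Subst (\<rho> @ \<rho>') w))"
      unfolding p q by (rule subst_mult_shuffle_add) (use p q in auto)
    moreover have "subst_comult (Subst (\<rho> @ \<rho>') w) = cut_add w G"
      if "set w = set \<sigma> \<union> set \<sigma>'" for w
      unfolding G_def by (rule subst_comult_cut_add) (use that p q in auto)
    ultimately show ?thesis
      by (simp add: additive_shuffle_add [OF additive_dWHA_comult] dWHA_comult_of cong: shuffle_add_cong)
  qed
  also have "\<dots> = cut_add \<sigma> (\<lambda>u1 u2. cut_add \<sigma>' (\<lambda>v1 v2.
      shuffle_add u1 v1 (\<lambda>x. shuffle_add u2 v2 (G x))))"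
    by (rule shuffle_add_cut_add)
  also have "\<dots> = ?mm (subst_comult p \<otimes>\<^sub>Z subst_comult q)"
  proof -
    let ?p = "\<lambda>x. frag_of (subst_part \<rho> x)" and ?q = "\<lambda>x. frag_of (subst_part \<rho>' x)"
    define P where "P = (\<lambda>x y. if set x \<inter> set y = {} then ?p x \<otimes>\<^sub>Z ?p y else 0)"
    define Q where "Q = (\<lambda>x y. if set x \<inter> set y = {} then ?q x \<otimes>\<^sub>Z ?q y else 0)"
    have "?mm (subst_comult p \<otimes>\<^sub>Z subst_comult q) = ?mm (cut_add \<sigma> P \<otimes>\<^sub>Z cut_add \<sigma>' Q)"
      unfolding p(1) q(1) subst_comult_cut_add [OF p(2)] subst_comult_cut_add [OF q(2)] P_def Q_def ..
    also have "\<dots> = cut_add \<sigma> (\<lambda>u1 u2. cut_add \<sigma>' (\<lambda>v1 v2. ?mm (P u1 u2 \<otimes>\<^sub>Z Q v1 v2)))"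
      unfolding additive_cut_add [OF additive_tens_left]
      by (simp only: additive_cut_add [OF additive_tens_right] additive_cut_add [OF mm])
    also have "\<dots> = cut_add \<sigma> (\<lambda>u1 u2. cut_add \<sigma>' (\<lambda>v1 v2. shuffle_add u1 v1 (\<lambda>x. shuffle_add u2 v2 (G x))))"
    proof (intro cut_add_cong)
      fix u1 u2 v1 v2 assume uv: "u1 @ u2 = \<sigma>" "v1 @ v2 = \<sigma>'"
      have sub: "set u1 \<subseteq> set \<rho>" "set u2 \<subseteq> set \<rho>" "set v1 \<subseteq> set \<rho>'" "set v2 \<subseteq> set \<rho>'"
        unfolding p(2) q(2) uv [symmetric] by simp_all
      \<comment> \<open>The left set is the support of any shuffle of the left parts, the right set
        that of any shuffle of the right parts. As the two words share no letters, overlap can arise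
        only within one word.\<close>
      have disj: "(set u1 \<union> set v1) \<inter> (set u2 \<union> set v2) = {} \<longleftrightarrow>
          set u1 \<inter> set u2 = {} \<and> set v1 \<inter> set v2 = {}"
        using q(3) sub by blast
      show "?mm (P u1 u2 \<otimes>\<^sub>Z Q v1 v2) = shuffle_add u1 v1 (\<lambda>x. shuffle_add u2 v2 (G x))"
      proof (cases "set u1 \<inter> set u2 = {} \<and> set v1 \<inter> set v2 = {}")
        case False
        then have "shuffle_add u1 v1 (\<lambda>x. shuffle_add u2 v2 (G x)) = shuffle_add u1 v1 (\<lambda>x. shuffle_add u2 v2 (\<lambda>y. 0))"
          using disj by (intro shuffle_add_cong) (simp only: G_def if_False)
        moreover have "P u1 u2 \<otimes>\<^sub>Z Q v1 v2 = 0" using False by (auto simp: P_def Q_def)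
        ultimately show ?thesis using additive.zero [OF mm] by simp
      next
        case True
        \<comment> \<open>Restricting \<open>\<rho> @ \<rho>'\<close> to the letters of a shuffle of
          \<open>x\<close> and \<open>y\<close> gives the concatenation of the separate
          restrictions, since letters of \<open>x\<close> do not occur in \<open>\<rho>'\<close> nor
          those of \<open>y\<close> in \<open>\<rho>\<close>.\<close>
        have mult: "subst_mult (subst_part \<rho> x) (subst_part \<rho>' y) = shuffle_add x y ?pq"
          if xy: "set x \<subseteq> set \<rho>" "set y \<subseteq> set \<rho>'" for x y
        proof -
          have "subst_mult (subst_part \<rho> x) (subst_part \<rho>' y) = shuffle_add x y
              (\<lambda>w. frag_of (Subst (filter (\<lambda>a. a \<in> set x) \<rho> @ filter (\<lambda>a. a \<in> set y) \<rho>') w))"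
            unfolding subst_part_def by (rule subst_mult_shuffle_add) (use xy q(3) in auto)
          also have "\<dots> = shuffle_add x y ?pq"
          proof (rule shuffle_add_cong)
            fix w assume w: "set w = set x \<union> set y"
            have "filter (\<lambda>a. a \<in> set w) \<rho> = filter (\<lambda>a. a \<in> set x) \<rho>"
              "filter (\<lambda>a. a \<in> set w) \<rho>' = filter (\<lambda>a. a \<in> set y) \<rho>'"
              using w xy q(3) by (auto intro!: filter_cong)
            then show "frag_of (Subst (filter (\<lambda>a. a \<in> set x) \<rho> @ filter (\<lambda>a. a \<in> set y) \<rho>') w) = ?pq w"
              by (simp add: subst_part_def)
          qed
          finally show ?thesis .
        qed
        have "?mm (P u1 u2 \<otimes>\<^sub>Z Q v1 v2) = shuffle_add u1 v1 ?pq \<otimes>\<^sub>Z shuffle_add u2 v2 ?pq"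
          using True by (simp add: P_def Q_def tensor_interchange_tens tensor_map_tens additive_dWHA_mult
              dWHA_mult_basis mult sub)
        also have "\<dots> = shuffle_add u1 v1 (\<lambda>x. shuffle_add u2 v2 (\<lambda>y. ?pq x \<otimes>\<^sub>Z ?pq y))"
          unfolding additive_shuffle_add [OF additive_tens_left]
          by (simp only: additive_shuffle_add [OF additive_tens_right])
        also have "\<dots> = shuffle_add u1 v1 (\<lambda>x. shuffle_add u2 v2 (G x))"
          using True disj by (intro shuffle_add_cong) (simp only: G_def if_True simp_thms)
        finally show ?thesis .
      qed
    qed
    finally show ?thesis ..
  qed
  finally show "(dWHA_comult \<circ> dWHA_mult) (frag_of p \<otimes>\<^sub>Z frag_of q) =
      (tensor_map dWHA_mult dWHA_mult \<circ> tensor_comult dWHA_comult) (frag_of p \<otimes>\<^sub>Z frag_of q)"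
    by (simp only: comp_apply tensor_comult_def dWHA_mult_basis dWHA_comult_of
        tensor_map_tens [OF additive_dWHA_comult additive_dWHA_comult])
qed

lemma shuffle_add_Nil_indicator: "shuffle_add u v (\<lambda>w. if w = [] then c else 0) = (if u = [] \<and> v = [] then c else 0)"
  by (cases u; cases v) simp_all

text \<open>Shuffling adds lengths, so the empty word arises only from two empty words, and then
  exactly once.\<close>

lemma dWHA_counit_mult: "dWHA_counit \<circ> dWHA_mult = tensor_counit dWHA_counit"
proof (rule additive_frag_tensor_ext)
  show "additive (dWHA_counit \<circ> dWHA_mult)" "additive (tensor_counit dWHA_counit)"
    unfolding tensor_counit_def
    by (intro additive_comp additive_tensor_map additive_dWHA_mult additive_dWHA_counit additive_int_mult)+
  fix p q
  obtain \<rho> \<sigma> where p: "p = Subst \<rho> \<sigma>" "set \<rho> = set \<sigma>" by (rule Subst_cases)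
  obtain \<rho>' \<sigma>' where q: "q = Subst \<rho>' \<sigma>'" "set \<rho>' = set \<sigma>'" "set \<rho>' \<inter> set \<rho> = {}"
    using Subst_cases_disjoint [of "set \<rho>"] by blast
  have "dWHA_counit (subst_mult p q) = shuffle_add \<sigma> \<sigma>' (\<lambda>w. dWHA_counit (frag_of (Subst (\<rho> @ \<rho>') w)))"
    unfolding p(1) q(1)
    by (subst subst_mult_shuffle_add) (use p q in \<open>auto simp: additive_shuffle_add [OF additive_dWHA_counit]\<close>)
  also have "\<dots> = shuffle_add \<sigma> \<sigma>' (\<lambda>w. if w = [] then 1 else 0)"
    by (rule shuffle_add_cong) (use p q in \<open>simp add: dWHA_counit_of Subst_eq_empty_iff\<close>)
  also have "\<dots> = dWHA_counit (frag_of p) * dWHA_counit (frag_of q)"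
    using p q by (simp add: shuffle_add_Nil_indicator dWHA_counit_of Subst_eq_empty_iff)
  finally show "(dWHA_counit \<circ> dWHA_mult) (frag_of p \<otimes>\<^sub>Z frag_of q) =
      tensor_counit dWHA_counit (frag_of p \<otimes>\<^sub>Z frag_of q)"
    by (simp add: tensor_counit_def dWHA_mult_basis int_mult_tens tensor_map_tens additive_dWHA_counit)
qed

lemma dWHA_comult_unit: "dWHA_comult \<circ> dWHA_unit = tensor_map dWHA_unit dWHA_unit \<circ> int_comult"
proof
  fix k
  have "subst_comult empty_subst = frag_of empty_subst \<otimes>\<^sub>Z frag_of empty_subst"
    by (subst subst_comult_cut_add) (simp_all add: subst_part_Nil)
  then show "(dWHA_comult \<circ> dWHA_unit) k = (tensor_map dWHA_unit dWHA_unit \<circ> int_comult) k"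
    by (simp add: dWHA_unit_zscale additive_zscale [OF additive_dWHA_comult] dWHA_comult_of int_comult_def
        tensor_map_tens additive_dWHA_unit tens_zscale)
qed

lemma dWHA_counit_unit: "dWHA_counit \<circ> dWHA_unit = id"
  by (rule ext) (simp add: dWHA_unit_zscale additive_zscale [OF additive_dWHA_counit] dWHA_counit_of)

lemma dWHA_bialgebra: "bialgebra dWHA_mult dWHA_unit dWHA_comult dWHA_counit"
  unfolding bialgebra_def coalgebra_hom_def
  using dWHA_algebra dWHA_coalgebra additive_dWHA_mult additive_dWHA_unit dWHA_comult_mult
    dWHA_counit_mult dWHA_comult_unit dWHA_counit_unit by blast


section \<open>The grading\<close>

lemma shuffle_add_closed:
  assumes "\<And>w. set w = set u \<union> set v \<Longrightarrow> F w \<in> B" "\<And>x y. x \<in> B \<Longrightarrow> y \<in> B \<Longrightarrow> x + y \<in> B"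
  shows "shuffle_add u v F \<in> B"
  using assms(1)
proof (induction u v F rule: shuffle_add.induct)
  case (3 a u b v F)
  have "shuffle_add u (b # v) (\<lambda>w. F (a # w)) \<in> B"
    by (rule 3(1)) (auto intro!: 3(3))
  moreover have "shuffle_add (a # u) v (\<lambda>w. F (b # w)) \<in> B"
    by (rule 3(2)) (auto intro!: 3(3))
  ultimately show ?case by (simp add: assms(2))
qed auto

lemma cut_add_closed:
  assumes "\<And>x y. x @ y = w \<Longrightarrow> F x y \<in> B" "\<And>x y. x \<in> B \<Longrightarrow> y \<in> B \<Longrightarrow> x + y \<in> B"
  shows "cut_add w F \<in> B"
  using assms(1) by (induction w F rule: cut_add.induct) (auto intro!: assms(2))

lemma frag_of_in_dWHA_grade: "frag_of p \<in> dWHA_grade n \<longleftrightarrow> subst_deg p = n"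
  by (simp add: dWHA_grade_def)

lemma zero_in_dWHA_grade: "0 \<in> dWHA_grade n"
  by (simp add: dWHA_grade_def)

lemma diff_in_dWHA_grade: "x \<in> dWHA_grade n \<Longrightarrow> y \<in> dWHA_grade n \<Longrightarrow> x - y \<in> dWHA_grade n"
  using keys_diff [of x y] by (auto simp: dWHA_grade_def)

lemma add_in_dWHA_grade: "x \<in> dWHA_grade n \<Longrightarrow> y \<in> dWHA_grade n \<Longrightarrow> x + y \<in> dWHA_grade n"
  using Poly_Mapping.keys_add [of x y] by (auto simp: dWHA_grade_def)

lemma dWHA_grade_additive_image:
  assumes "additive f" "x \<in> dWHA_grade n" "\<And>p. subst_deg p = n \<Longrightarrow> f (frag_of p) \<in> B"
    and "0 \<in> B" "\<And>x y. x \<in> B \<Longrightarrow> y \<in> B \<Longrightarrow> x - y \<in> B"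
  shows "f x \<in> B"
proof -
  interpret additive f by fact
  have "Poly_Mapping.keys x \<subseteq> {p. subst_deg p = n}"
    using assms(2) by (auto simp: dWHA_grade_def)
  then show ?thesis
    by (induction x rule: frag_induction) (use assms(3-5) in \<open>auto simp: zero diff\<close>)
qed

definition dWHA_component :: "nat \<Rightarrow> dWHA \<Rightarrow> dWHA" where
  "dWHA_component n = free_lift (\<lambda>p. if subst_deg p = n then frag_of p else 0)"

lemma additive_dWHA_component: "additive (dWHA_component n)"
  unfolding dWHA_component_def by (rule additive_free_lift)

lemma lookup_dWHA_component:
  "Poly_Mapping.lookup (dWHA_component n x) p = (if subst_deg p = n then Poly_Mapping.lookup x p else 0)"
proof -
  have "(\<lambda>x. Poly_Mapping.lookup (dWHA_component n x) p) =
      (\<lambda>x. if subst_deg p = n then Poly_Mapping.lookup x p else 0)"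
  proof (rule additive_frag_ext)
    show "additive (\<lambda>x. Poly_Mapping.lookup (dWHA_component n x) p)"
      "additive (\<lambda>x. if subst_deg p = n then Poly_Mapping.lookup x p else 0)"
      by (simp_all add: additive_def additive.add [OF additive_dWHA_component] lookup_add)
  qed (auto simp: dWHA_component_def lookup_single when_def)
  then show ?thesis by (rule fun_cong)
qed

lemma dWHA_component_grade:
  assumes "x \<in> dWHA_grade m"
  shows "dWHA_component n x = (if m = n then x else 0)"
  by (rule poly_mapping_eqI)
    (use assms in \<open>auto simp: lookup_dWHA_component dWHA_grade_def in_keys_iff\<close>)

lemma dWHA_component_in_grade: "dWHA_component n x \<in> dWHA_grade n"
  by (auto simp: dWHA_grade_def in_keys_iff lookup_dWHA_component split: if_splits)

lemma dWHA_grading: "grading dWHA_grade"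
  unfolding grading_def
proof (intro conjI allI ballI)
  show "0 \<in> dWHA_grade n" for n by (rule zero_in_dWHA_grade)
  show "x - y \<in> dWHA_grade n" if "x \<in> dWHA_grade n" "y \<in> dWHA_grade n" for n x y
    using that by (rule diff_in_dWHA_grade)
  fix x
  let ?c = "\<lambda>n. dWHA_component n x"
  \<comment> \<open>The degrees occurring in \<open>x\<close>: a finite index set over which the
    components can be summed coefficientwise.\<close>
  let ?D = "subst_deg ` Poly_Mapping.keys x"
  have sub: "{n. ?c n \<noteq> 0} \<subseteq> ?D"
  proof
    fix n assume "n \<in> {n. ?c n \<noteq> 0}"
    then have "Poly_Mapping.keys (?c n) \<noteq> {}" by simp
    then obtain p where "p \<in> Poly_Mapping.keys (?c n)" by blast
    then show "n \<in> ?D" by (auto simp: in_keys_iff lookup_dWHA_component split: if_splits)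
  qed
  then have fin: "finite {n. ?c n \<noteq> 0}" by (rule finite_subset) simp
  have "(\<Sum>n | ?c n \<noteq> 0. ?c n) = (\<Sum>n\<in>?D. ?c n)"
    by (rule sum.mono_neutral_left) (use sub in auto)
  also have "\<dots> = x"
    by (rule poly_mapping_eqI) (auto simp: lookup_sum lookup_dWHA_component in_keys_iff)
  finally have x: "x = (\<Sum>n | ?c n \<noteq> 0. ?c n)" ..
  show "\<exists>!c. finite {n. c n \<noteq> 0} \<and> (\<forall>n. c n \<in> dWHA_grade n) \<and> x = (\<Sum>n | c n \<noteq> 0. c n)"
  proof (rule ex1I [of _ ?c])
    show "finite {n. ?c n \<noteq> 0} \<and> (\<forall>n. ?c n \<in> dWHA_grade n) \<and> x = (\<Sum>n | ?c n \<noteq> 0. ?c n)"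
      using fin dWHA_component_in_grade x by blast
    fix c assume c: "finite {n. c n \<noteq> 0} \<and> (\<forall>n. c n \<in> dWHA_grade n) \<and> x = (\<Sum>n | c n \<noteq> 0. c n)"
    show "c = ?c"
    proof
      fix n
      \<comment> \<open>Uniqueness: applying the projection to degree \<open>n\<close> to any
        homogeneous decomposition picks out its \<open>n\<close>-th entry.\<close>
      have "?c n = (\<Sum>m | c m \<noteq> 0. dWHA_component n (c m))"
        using c additive.sum [OF additive_dWHA_component] by metis
      also have "\<dots> = (\<Sum>m | c m \<noteq> 0. if m = n then c m else 0)"
        using c by (intro sum.cong refl dWHA_component_grade) blast
      also have "\<dots> = c n" using c by (simp add: sum.delta)
      finally show "c n = ?c n" ..
    qed
  qed
qed

text \<open>All terms share the first row \<open>\<rho> @ \<rho>'\<close>, whose support is a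
  disjoint union, so cardinalities add.\<close>

lemma subst_mult_in_grade: "subst_mult p q \<in> dWHA_grade (subst_deg p + subst_deg q)"
proof -
  obtain \<rho> \<sigma> where p: "p = Subst \<rho> \<sigma>" "set \<rho> = set \<sigma>" by (rule Subst_cases)
  obtain \<rho>' \<sigma>' where q: "q = Subst \<rho>' \<sigma>'" "set \<rho>' = set \<sigma>'" "set \<rho>' \<inter> set \<rho> = {}"
    using Subst_cases_disjoint [of "set \<rho>"] by blast
  have "subst_mult p q = shuffle_add \<sigma> \<sigma>' (\<lambda>w. frag_of (Subst (\<rho> @ \<rho>') w))"
    unfolding p q by (rule subst_mult_shuffle_add) (use p q in auto)
  also have "\<dots> \<in> dWHA_grade (subst_deg p + subst_deg q)"
  proof (rule shuffle_add_closed)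
    fix w assume w: "set w = set \<sigma> \<union> set \<sigma>'"
    have "subst_deg (Subst (\<rho> @ \<rho>') w) = card (set \<rho> \<union> set \<rho>')"
      by (subst subst_deg_Subst) (use w p q in auto)
    also have "\<dots> = card (set \<rho>) + card (set \<rho>')"
      by (rule card_Un_disjoint) (use q in auto)
    finally show "frag_of (Subst (\<rho> @ \<rho>') w) \<in> dWHA_grade (subst_deg p + subst_deg q)"
      using p q by (simp add: frag_of_in_dWHA_grade subst_deg_Subst)
  qed (rule add_in_dWHA_grade)
  finally show ?thesis .
qed

lemma dWHA_mult_in_grade:
  assumes "x \<in> dWHA_grade i" "y \<in> dWHA_grade j"
  shows "dWHA_mult (x \<otimes>\<^sub>Z y) \<in> dWHA_grade (i + j)"
proof -
  have 1: "(dWHA_mult \<circ> (\<lambda>y. frag_of p \<otimes>\<^sub>Z y)) y \<in> dWHA_grade (i + j)" if "subst_deg p = i" for p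
  proof (rule dWHA_grade_additive_image [OF _ assms(2)])
    show "additive (dWHA_mult \<circ> (\<lambda>y. frag_of p \<otimes>\<^sub>Z y))"
      by (intro additive_comp additive_dWHA_mult additive_tens_right)
    show "(dWHA_mult \<circ> (\<lambda>y. frag_of p \<otimes>\<^sub>Z y)) (frag_of q) \<in> dWHA_grade (i + j)" if "subst_deg q = j" for q
      using subst_mult_in_grade [of p q] \<open>subst_deg p = i\<close> that by (simp add: dWHA_mult_basis)
  qed (rule zero_in_dWHA_grade diff_in_dWHA_grade; assumption)+
  have "(dWHA_mult \<circ> (\<lambda>x. x \<otimes>\<^sub>Z y)) x \<in> dWHA_grade (i + j)"
  proof (rule dWHA_grade_additive_image [OF _ assms(1)])
    show "additive (dWHA_mult \<circ> (\<lambda>x. x \<otimes>\<^sub>Z y))"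
      by (intro additive_comp additive_dWHA_mult additive_tens_left)
    show "(dWHA_mult \<circ> (\<lambda>x. x \<otimes>\<^sub>Z y)) (frag_of p) \<in> dWHA_grade (i + j)" if "subst_deg p = i" for p
      using 1 [OF that] by simp
  qed (rule zero_in_dWHA_grade diff_in_dWHA_grade; assumption)+
  then show ?thesis by simp
qed

text \<open>Goodness is what makes the coproduct homogeneous: a good cut partitions the support,
  whereas a letter on both sides would be counted twice.\<close>

lemma subst_comult_in_tensor_grade: "subst_comult p \<in> tensor_grade dWHA_grade (subst_deg p)"
proof -
  obtain \<rho> \<sigma> where p: "p = Subst \<rho> \<sigma>" "set \<rho> = set \<sigma>" by (rule Subst_cases)
  show ?thesis
    unfolding p(1) subst_comult_cut_add [OF p(2)]
  proof (rule cut_add_closed)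
    fix x y assume xy: "x @ y = \<sigma>"
    have "frag_of (subst_part \<rho> x) \<otimes>\<^sub>Z frag_of (subst_part \<rho> y) \<in> tensor_grade dWHA_grade (subst_deg (Subst \<rho> \<sigma>))"
      if d: "set x \<inter> set y = {}"
    proof -
      have "subst_deg (subst_part \<rho> x) + subst_deg (subst_part \<rho> y) = card (set x) + card (set y)"
        by (subst (1 2) subst_deg_part) (simp_all add: p(2) xy [symmetric])
      also have "\<dots> = card (set x \<union> set y)" using d by (simp add: card_Un_disjoint)
      also have "\<dots> = subst_deg (Subst \<rho> \<sigma>)" by (simp add: subst_deg_Subst p(2) xy [symmetric])
      finally have "frag_of (subst_part \<rho> x) \<otimes>\<^sub>Z frag_of (subst_part \<rho> y) \<in>
          {a \<otimes>\<^sub>Z b |a b i j. a \<in> dWHA_grade i \<and> b \<in> dWHA_grade j \<and> i + j = subst_deg (Subst \<rho> \<sigma>)}"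
        using frag_of_in_dWHA_grade by blast
      then show ?thesis unfolding tensor_grade_def by (simp add: group_closure.base)
    qed
    then show "(if set x \<inter> set y = {} then frag_of (subst_part \<rho> x) \<otimes>\<^sub>Z frag_of (subst_part \<rho> y) else 0)
        \<in> tensor_grade dWHA_grade (subst_deg (Subst \<rho> \<sigma>))"
      by (auto simp: tensor_grade_def)
  qed (auto simp: tensor_grade_def intro: group_closure_add)
qed

lemma dWHA_connected_graded_bialgebra:
  "connected_graded_bialgebra dWHA_grade dWHA_mult dWHA_unit dWHA_comult dWHA_counit"
  unfolding connected_graded_bialgebra_def graded_bialgebra_def
proof (intro conjI allI impI)
  show "bialgebra dWHA_mult dWHA_unit dWHA_comult dWHA_counit" by (rule dWHA_bialgebra)
  show "grading dWHA_grade" by (rule dWHA_grading)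
  fix n
  show "dWHA_mult ` tensor_grade dWHA_grade n \<subseteq> dWHA_grade n"
  proof
    fix y assume "y \<in> dWHA_mult ` tensor_grade dWHA_grade n"
    then obtain t where t: "t \<in> tensor_grade dWHA_grade n" "y = dWHA_mult t" by blast
    show "y \<in> dWHA_grade n"
      unfolding t(2)
      by (rule group_closure_additive_image [OF additive_dWHA_mult t(1) [unfolded tensor_grade_def]])
        (auto intro: dWHA_mult_in_grade zero_in_dWHA_grade diff_in_dWHA_grade)
  qed
  show "dWHA_comult ` dWHA_grade n \<subseteq> tensor_grade dWHA_grade n"
  proof
    fix y assume "y \<in> dWHA_comult ` dWHA_grade n"
    then obtain x where x: "x \<in> dWHA_grade n" "y = dWHA_comult x" by blast
    show "y \<in> tensor_grade dWHA_grade n"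
      unfolding x(2)
    proof (rule dWHA_grade_additive_image [OF additive_dWHA_comult x(1)])
      show "dWHA_comult (frag_of p) \<in> tensor_grade dWHA_grade n" if "subst_deg p = n" for p
        using subst_comult_in_tensor_grade [of p] that by (simp add: dWHA_comult_of)
    qed (auto simp: tensor_grade_def intro: group_closure.diff)
  qed
  show "dWHA_counit ` dWHA_grade n \<subseteq> {0}" if "n > 0"
  proof
    fix y assume "y \<in> dWHA_counit ` dWHA_grade n"
    then obtain x where x: "x \<in> dWHA_grade n" "y = dWHA_counit x" by blast
    show "y \<in> {0}"
      unfolding x(2)
      by (rule dWHA_grade_additive_image [OF additive_dWHA_counit x(1)])
        (use that subst_deg_eq_0_iff [of empty_subst] in \<open>auto simp: dWHA_counit_of\<close>)
  qed
next
  have deg: "subst_deg empty_subst = 0" by (simp add: subst_deg_eq_0_iff)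
  show unit: "range dWHA_unit \<subseteq> dWHA_grade 0"
    by (auto simp: dWHA_unit_def dWHA_grade_def deg)
  \<comment> \<open>An element of degree 0 can have a nonzero coefficient only at
    \<open>empty_subst\<close>, so that coefficient is its preimage under the unit.\<close>
  have "dWHA_unit (Poly_Mapping.lookup x empty_subst) = x" if "x \<in> dWHA_grade 0" for x
  proof (rule poly_mapping_eqI)
    fix p
    show "Poly_Mapping.lookup (dWHA_unit (Poly_Mapping.lookup x empty_subst)) p = Poly_Mapping.lookup x p"
    proof (cases "p = empty_subst")
      case False
      then have "p \<notin> Poly_Mapping.keys x"
        using that subst_deg_eq_0_iff by (auto simp: dWHA_grade_def)
      with False show ?thesis by (simp add: dWHA_unit_def lookup_single in_keys_iff)
    qed (simp add: dWHA_unit_def)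
  qed
  then have "dWHA_grade 0 \<subseteq> range dWHA_unit" by (metis rangeI subsetI)
  moreover have "inj dWHA_unit"
    \<comment> \<open>The counit is a left inverse of the unit.\<close>
    by (rule inj_on_inverseI [of _ dWHA_counit]) (use fun_cong [OF dWHA_counit_unit] in simp)
  ultimately show "bij_betw dWHA_unit UNIV (dWHA_grade 0)"
    using unit by (auto simp: bij_betw_def)
qed

theorem theorem6p7:
  shows "connected_graded_bialgebra dWHA_grade dWHA_mult dWHA_unit dWHA_comult dWHA_counit \<and>
    algebra_hom dWHA_mult dWHA_unit (tensor_mult dWHA_mult) (tensor_unit dWHA_unit) dWHA_comult \<and>
    algebra_hom dWHA_mult dWHA_unit int_mult id dWHA_counit \<and>
    (\<exists>S. connected_graded_Hopf_algebra dWHA_grade dWHA_mult dWHA_unit dWHA_comult dWHA_counit S)"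
proof (intro conjI)
  show "connected_graded_bialgebra dWHA_grade dWHA_mult dWHA_unit dWHA_comult dWHA_counit"
    by (rule dWHA_connected_graded_bialgebra)
  then show "\<exists>S. connected_graded_Hopf_algebra dWHA_grade dWHA_mult dWHA_unit dWHA_comult dWHA_counit S"
    by (rule connected_graded_bialgebra_antipode)
  show "algebra_hom dWHA_mult dWHA_unit (tensor_mult dWHA_mult) (tensor_unit dWHA_unit) dWHA_comult"
    \<comment> \<open>The same equations as for the coalgebra morphisms \<open>dWHA_mult\<close> and
      \<open>dWHA_unit\<close>: \<open>tensor_interchange\<close> is merely grouped with the
      multiplication instead of the comultiplication.\<close>
    using additive_dWHA_comult dWHA_comult_mult dWHA_comult_unit
    by (simp only: algebra_hom_def tensor_mult_def tensor_unit_def tensor_comult_def comp_assoc simp_thms)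
  show "algebra_hom dWHA_mult dWHA_unit int_mult id dWHA_counit"
    using additive_dWHA_counit dWHA_counit_mult dWHA_counit_unit
    by (simp only: algebra_hom_def tensor_counit_def simp_thms)
qed

end
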